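(* For any integer $q\ge2$, $\varepsilon>0$ and sufficiently large $n$, let $C^q_{n,\varepsilon}=\{A^q_{r,n}: r=(1/\varepsilon^4)^k,\ k\text{ a nonnegative integer},\ k<\log_{1/\varepsilon^4}n\}$. For any $(\gamma,\delta)\in(1-\varepsilon)F_q$, $C^q_{n,\varepsilon}$ is list decodable from any $\delta n$ deletions and $\gamma n$ insertions with list size $O(q^5/\varepsilon^2)$; equivalently, for every $z\in\{1,\dots,q-1\}$ and all $\gamma,\delta\ge 0$ with $\gamma+2z\delta\le(1-\varepsilon)\frac{(2q-1)z-z^2}{q}$, every string $v$ can be obtained from at most $O(q^5/\varepsilon^2)$ codewords of $C^q_{n,\varepsilon}$ by at most $\delta n$ deletions and at most $\gamma n$ insertions.
   Context: For a positive integer $r$, $A^q_r=(1^r2^r\cdots q^r)^\infty$ is the infinite string over $\{1,\dots,q\}$ cycling through runs of length $r$ of each symbol, and $A^q_{r,l}$ is its prefix of length $l$. $F_q=\{(\gamma,\delta):\gamma,\delta\ge0,\ \exists z\in\{1,\dots,q-1\}:\ \gamma+2z\delta<\frac{(2q-1)z-z^2}{q}\}$ (the polygon with vertices $(0,0)$ and $(\frac{i(i-1)}q,\frac{q-i}q)$, $i=1,\dots,q$, without its boundary except the segments $[(0,0),(q-1,0))$ and $[(0,0),(0,1-\frac1q))$), and $(1-\varepsilon)F_q$ is its scaling by $1-\varepsilon$. A string $y$ is obtained from $x$ by $D$ deletions and $I$ insertions if it results from deleting $D$ symbols of $x$ and inserting $I$ symbols. *)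

theory Defs
  imports Complex_Main "HOL-Library.Sublist"
begin

text \<open>Strings over the alphabet {1,...,q} are lists of naturals.
  A_prefix q r l is the length-l prefix of (1^r 2^r ... q^r)^infinity;
  position i (0-indexed) carries symbol ((i div r) mod q) + 1.\<close>
definition A_prefix :: "nat \<Rightarrow> nat \<Rightarrow> nat \<Rightarrow> nat list" where
  "A_prefix q r l = map (\<lambda>i. (i div r) mod q + 1) [0..<l]"

definition obtained_by_del_ins :: "'a list \<Rightarrow> 'a list \<Rightarrow> nat \<Rightarrow> nat \<Rightarrow> bool" where
  "obtained_by_del_ins x y D I \<longleftrightarrow>
     (\<exists>s. subseq s x \<and> subseq s y \<and> length x = length s + D \<and> length y = length s + I)"

definition code_C :: "nat \<Rightarrow> real \<Rightarrow> nat \<Rightarrow> nat list set" where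
  "code_C q \<epsilon> n = {A_prefix q (nat \<lfloor>(1 / \<epsilon> ^ 4) ^ k\<rfloor>) n | k::nat. real k < log (1 / \<epsilon> ^ 4) (real n)}"

end

theory Submission
  imports Defs
begin

text \<open>
  Write \<open>L\<close> for the length of a common subsequence of \<open>v\<close> and \<open>A\<^sub>r\<close>. The distance condition says that
  \<open>(2 z + 1) L - |v|\<close> exceeds \<open>n z (z + 1) / q\<close> by \<open>\<epsilon> n z\<close>. If the symbol densities of \<open>v\<close> were constant on
  every part matched to one period of \<open>A\<^sub>r\<close>, the excess would be at most \<open>0\<close>. Hence the densities of
  \<open>v\<close> on cells slightly shorter than \<open>r\<close> deviate from those on cells slightly longer than \<open>r\<close>, so the
  mean square density drops by about \<open>\<epsilon>\<^sup>2 / q\<^sup>2\<close> between these two scales. The total drop over all dyadic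
  scales is at most \<open>1\<close>, and each scale is used by few codewords because the run lengths grow
  geometrically. When \<open>\<epsilon>\<close> is so close to \<open>1\<close> that this growth is too slow, the codewords in
  the list are compared with each other directly.
\<close>

section \<open>Subsequences, symbol counts and cut points\<close>

text \<open>Two embeddings into \<open>v\<close> share at least \<open>|s| + |t| - |v|\<close>
  positions, and the symbols there form \<open>u\<close>. Hence two codewords close to the same
  \<open>v\<close> are close to each other.\<close>

lemma subseq_common_part:
  assumes "subseq s v" "subseq t v"
  shows "\<exists>u. subseq u s \<and> subseq u t \<and> length s + length t \<le> length u + length v"
  using assms
proof (induction v arbitrary: s t rule: list.induct)
  case Nil
  then show ?case by auto
next
  case (Cons a v)
  have drop_head: "\<exists>s'. subseq s' v \<and> (s' = s \<or> s = a # s')" if "subseq s (a # v)" for s :: "'a list"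
    using that by (cases s) (auto split: if_splits)
  obtain s' where s': "subseq s' v" "s' = s \<or> s = a # s'" using drop_head Cons.prems(1) by blast
  obtain t' where t': "subseq t' v" "t' = t \<or> t = a # t'" using drop_head Cons.prems(2) by blast
  obtain u where u: "subseq u s'" "subseq u t'" "length s' + length t' \<le> length u + length v"
    using Cons.IH[OF s'(1) t'(1)] by blast
  show ?case
  proof (cases "s = a # s' \<and> t = a # t'")
    case True
    then show ?thesis using u by (intro exI[of _ "a # u"]) auto
  next
    case False
    then have "subseq u s" "subseq u t" using u s'(2) t'(2) by auto
    then show ?thesis using u False s'(2) t'(2) by (intro exI[of _ u]) auto
  qed
qed

text \<open>Being zero beyond the end of \<open>v\<close>, these indicators can be summed over any
  whole number of cells.\<close>

definition occ :: "'a list \<Rightarrow> 'a \<Rightarrow> nat \<Rightarrow> real" where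
  "occ v c x = of_bool (x < length v \<and> v ! x = c)"

lemma occ_nonneg: "0 \<le> occ v c x" and occ_le_1: "occ v c x \<le> 1"
  by (auto simp: occ_def)

lemma sum_occ_eq_count: "(\<Sum>x<length v. occ v c x) = real (count_list v c)"
proof (induction v rule: rev_induct)
  case (snoc a v)
  have "(\<Sum>x<length v. occ (v @ [a]) c x) = (\<Sum>x<length v. occ v c x)"
    by (rule sum.cong) (auto simp: occ_def nth_append)
  then show ?case using snoc by (simp add: occ_def)
qed simp

lemma sum_occ_append:
  "(\<Sum>x\<in>{length v..<length (v @ w)}. occ (v @ w) c x) = real (count_list w c)"
proof -
  have "(\<Sum>x\<in>{length v..<length (v @ w)}. occ (v @ w) c x) = (\<Sum>x<length w. occ w c x)"
    by (rule sum.reindex_bij_witness[of _ "\<lambda>x. x + length v" "\<lambda>x. x - length v"])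
      (auto simp: occ_def nth_append)
  then show ?thesis by (simp add: sum_occ_eq_count)
qed

lemma subseq_replicateD:
  assumes "subseq s (replicate k c)" "subseq s w"
  shows "length s \<le> k" "length s \<le> count_list w c"
proof -
  show "length s \<le> k" using list_emb_length[OF assms(1)] by simp
  have "s = replicate (length s) c"
  proof (intro replicate_length_same[symmetric] ballI)
    fix x assume "x \<in> set s"
    then obtain y where "y \<in> set (replicate k c)" "x = y"
      using list_emb_set[OF assms(1), of x] by blast
    then show "x = c" by simp
  qed
  then have "count_list s c = length s"
    by (metis count_list_eq_length_filter filter_replicate length_replicate)
  moreover have "count_list s c \<le> count_list w c"
    using assms(2) by (induction rule: list_emb.induct) auto
  ultimately show "length s \<le> count_list w c" by simp
qed

text \<open>\<open>v\<close> is cut where the embedding of \<open>s\<close> passes from one run to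
  the next; within a piece a single symbol is matched, so its occurrences bound the match. Without
  any run, \<open>t 0 = 0\<close> fixes the right end already, hence the guard
  \<open>K > 0\<close>.\<close>

lemma subseq_runs_cut_points:
  assumes "subseq s (concat (map (\<lambda>i. replicate (len i) (c i)) [0..<K]))" "subseq s v"
  shows "\<exists>t L. mono t \<and> t 0 = 0 \<and> (K > 0 \<longrightarrow> t K = length v) \<and> length s = (\<Sum>i<K. L i) \<and>
    (\<forall>i<K. L i \<le> len i \<and> real (L i) \<le> (\<Sum>x\<in>{t i..<t (Suc i)}. occ v (c i) x))"
  using assms
proof (induction K arbitrary: s v)
  case 0
  then show ?case by (intro exI[of _ "\<lambda>_. 0"]) (auto simp: mono_def)
next
  case (Suc K)
  obtain s1 s2 where s: "s = s1 @ s2" "subseq s1 (concat (map (\<lambda>i. replicate (len i) (c i)) [0..<K]))"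
    "subseq s2 (replicate (len K) (c K))"
    using Suc.prems(1) by (auto simp: subseq_append_iff)
  obtain v1 v2 where v: "v = v1 @ v2" "subseq s1 v1" "subseq s2 v2"
    using Suc.prems(2) unfolding s(1) by (auto dest: list_emb_appendD)
  obtain t L where tL: "mono t" "t 0 = 0" "K > 0 \<longrightarrow> t K = length v1" "length s1 = (\<Sum>i<K. L i)"
    and L: "\<And>i. i < K \<Longrightarrow> L i \<le> len i \<and> real (L i) \<le> (\<Sum>x\<in>{t i..<t (Suc i)}. occ v1 (c i) x)"
    using Suc.IH[OF s(2) v(2)] by blast
  define t' where "t' = (\<lambda>i. if i \<le> K then t i else length v)"
  define L' where "L' = (\<lambda>i. if i < K then L i else length s2)"
  have tK: "t K \<le> length v1" using tL(2,3) by (cases "K = 0") auto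
  have t_le: "t i \<le> length v1" if "i \<le> K" for i
    using monoD[OF tL(1) that] tK by linarith
  have "mono t'"
    unfolding t'_def mono_def using tL(1) t_le v(1) by (auto simp: mono_def intro: trans_le_add1)
  moreover have "length s = (\<Sum>i<Suc K. L' i)"
    using s(1) tL(4) by (simp add: L'_def)
  moreover have "L' i \<le> len i \<and> real (L' i) \<le> (\<Sum>x\<in>{t' i..<t' (Suc i)}. occ v (c i) x)"
    if "i < Suc K" for i
  proof (cases "i < K")
    case True
    have "(\<Sum>x\<in>{t i..<t (Suc i)}. occ v (c i) x) = (\<Sum>x\<in>{t i..<t (Suc i)}. occ v1 (c i) x)"
      using t_le[of "Suc i"] True
      by (intro sum.cong) (auto simp: occ_def v(1) nth_append)
    then show ?thesis using L[OF True] True by (simp add: t'_def L'_def)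
  next
    case False
    then have [simp]: "i = K" using that by simp
    have "real (length s2) \<le> (\<Sum>x\<in>{length v1..<length v}. occ v (c K) x)"
      using subseq_replicateD[OF s(3) v(3)] by (simp only: v(1) sum_occ_append)
    \<comment> \<open>For \<open>K = 0\<close> the cut \<open>t 0 = 0\<close> may lie before the end
      of \<open>v1\<close>; enlarging the last piece only adds nonnegative terms.\<close>
    also have "\<dots> \<le> (\<Sum>x\<in>{t K..<length v}. occ v (c K) x)"
      using tK by (intro sum_mono2) (auto simp: occ_nonneg)
    finally show ?thesis using subseq_replicateD[OF s(3) v(3)] by (simp add: t'_def L'_def)
  qed
  ultimately show ?case
    by (intro exI[of _ t'] exI[of _ L'] conjI) (simp_all add: t'_def tL(2))
qed

section \<open>Common subsequences of two codewords\<close>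

lemma A_prefix_add: "A_prefix q r (a + b) = A_prefix q r a @ map (\<lambda>i. (i div r) mod q + 1) [a..<a + b]"
  using upt_add_eq_append[of 0 a b] by (simp add: A_prefix_def)

lemma A_prefix_runs: "r > 0 \<Longrightarrow>
  A_prefix q r (K * r) = concat (map (\<lambda>i. replicate r (i mod q + 1)) [0..<K])"
proof (induction K)
  case (Suc K)
  have "map (\<lambda>i. (i div r) mod q + 1) [K * r..<K * r + r] = replicate r (K mod q + 1)"
    using Suc.prems by (intro nth_equalityI) auto
  then have "A_prefix q r (K * r + r) = A_prefix q r (K * r) @ replicate r (K mod q + 1)"
    by (simp only: A_prefix_add)
  moreover have "Suc K * r = K * r + r" by simp
  ultimately have "A_prefix q r (Suc K * r) = A_prefix q r (K * r) @ replicate r (K mod q + 1)"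
    by (simp only:)
  then show ?case unfolding Suc.IH[OF Suc.prems] by simp
qed (simp add: A_prefix_def)

lemma length_A_prefix [simp]: "length (A_prefix q r n) = n"
  by (simp add: A_prefix_def)

text \<open>Shifting by \<open>r\<close> maps the positions of a symbol injectively to positions of other symbols.\<close>
lemma occ_A_prefix_interval:
  assumes "q \<ge> 2" "r > 0" "b \<le> n" "a \<le> b"
  shows "2 * (\<Sum>x\<in>{a..<b}. occ (A_prefix q r n) c x) \<le> real (b - a) + real r"
proof -
  define P where "P = {x\<in>{a..<b}. (x div r) mod q + 1 = c}"
  have "(\<Sum>x\<in>{a..<b}. occ (A_prefix q r n) c x) = (\<Sum>x\<in>{a..<b}. of_bool ((x div r) mod q + 1 = c))"
    using assms by (intro sum.cong) (auto simp: occ_def A_prefix_def)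
  also have "\<dots> = real (card P)"
    by (simp add: P_def Int_def)
  finally have sum: "(\<Sum>x\<in>{a..<b}. occ (A_prefix q r n) c x) = real (card P)" .
  have fin: "finite P" by (simp add: P_def)
  have shift: "x + r \<in> {a..<b} - P" if "x \<in> P" "x + r < b" for x
  proof -
    have "(x + r) div r = Suc (x div r)" using assms by simp
    moreover have "Suc (x div r) mod q \<noteq> (x div r) mod q"
      using assms by (simp add: mod_Suc)
    ultimately show ?thesis using that by (auto simp: P_def)
  qed
  have "card {x\<in>P. x + r < b} \<le> card ({a..<b} - P)"
    by (rule card_inj_on_le[of "\<lambda>x. x + r"]) (use shift in auto)
  also have "\<dots> = (b - a) - card P"
    by (subst card_Diff_subset) (auto simp: P_def)
  finally have "card {x\<in>P. x + r < b} \<le> (b - a) - card P" .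
  \<comment> \<open>Positions whose shift leaves the interval lie in its last \<open>r\<close>
    places, the source of the error term \<open>r\<close>.\<close>
  moreover have "card {x\<in>P. \<not> x + r < b} \<le> card {b - r..<b}"
    by (rule card_mono) (auto simp: P_def)
  moreover have "card P = card {x\<in>P. x + r < b} + card {x\<in>P. \<not> x + r < b}"
    using fin by (subst card_Un_disjoint[symmetric]) (auto intro: arg_cong[where f = card])
  moreover have "card P \<le> b - a"
    using card_mono[of "{a..<b}" P] unfolding P_def by fastforce
  ultimately have "2 * card P \<le> (b - a) + r" by simp
  then show ?thesis unfolding sum by linarith
qed

lemma sum_cut_points:
  fixes f :: "nat \<Rightarrow> real"
  assumes "mono (t :: nat \<Rightarrow> nat)"
  shows "(\<Sum>i<K. \<Sum>x\<in>{t i..<t (Suc i)}. f x) = (\<Sum>x\<in>{t 0..<t K}. f x)"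
proof (induction K)
  case (Suc K)
  then show ?case
    using sum.atLeastLessThan_concat[of "t 0" "t K" "t (Suc K)" f] monoD[OF assms] by simp
qed simp

text \<open>Each full run of length \<open>r'\<close> is matched inside an interval of the other
  codeword, where its symbol occurs at most half the length plus \<open>r / 2\<close> times. So
  \<open>s\<close> falls short of \<open>n\<close> by at least \<open>(r' - r) / 2\<close> for each
  of the \<open>n div r'\<close> full runs.\<close>

lemma common_subseq_A_prefix:
  assumes "q \<ge> 2" "0 < r" "0 < r'" "subseq s (A_prefix q r n)" "subseq s (A_prefix q r' n)"
  shows "2 * length s + (n div r') * r' \<le> 2 * n + (n div r') * r"
proof -
  define K where "K = n div r'"
  define len where "len = (\<lambda>i. if i < K then r' else n mod r')"
  define c where "c = (\<lambda>i. i mod q + 1)"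
  have last_run: "(K * r' + i) div r' = K" if "i < n mod r'" for i
    using that mod_less_divisor[OF assms(3), of n] by (intro div_nat_eqI) (auto simp: algebra_simps)
  have rem: "map (\<lambda>i. (i div r') mod q + 1) [K * r'..<K * r' + n mod r'] = replicate (n mod r') (c K)"
    by (rule nth_equalityI) (simp_all add: c_def last_run)
  have "A_prefix q r' n = concat (map (\<lambda>i. replicate (len i) (c i)) [0..<Suc K])"
  proof -
    have "A_prefix q r' n = A_prefix q r' (K * r') @ replicate (n mod r') (c K)"
      using A_prefix_add[of q r' "K * r'" "n mod r'"] rem by (simp add: K_def)
    also have "A_prefix q r' (K * r') = concat (map (\<lambda>i. replicate (len i) (c i)) [0..<K])"
      unfolding A_prefix_runs[OF assms(3)]
      by (intro arg_cong[where f = concat] map_cong) (auto simp: len_def c_def)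
    finally show ?thesis by (simp add: len_def)
  qed
  then have "subseq s (concat (map (\<lambda>i. replicate (len i) (c i)) [0..<Suc K]))"
    using assms(5) by simp
  from subseq_runs_cut_points[OF this assms(4)] obtain t L where
    t: "mono t" "t 0 = 0" "t (Suc K) = n" and s: "length s = (\<Sum>i<Suc K. L i)"
    and L: "\<And>i. i < Suc K \<Longrightarrow> L i \<le> len i \<and>
      real (L i) \<le> (\<Sum>x\<in>{t i..<t (Suc i)}. occ (A_prefix q r n) (c i) x)"
    by auto
  have t_mono: "t i \<le> t j" if "i \<le> j" for i j using monoD[OF t(1) that] .
  have "2 * real (L i) \<le> real (t (Suc i) - t i) + real r" if "i < K" for i
    using L[of i] that occ_A_prefix_interval[of q r "t (Suc i)" n "t i" "c i"] assms(1,2)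
      t_mono[of "Suc i" "Suc K"] t_mono[of i "Suc i"] t(3) by simp
  then have "(\<Sum>i<K. 2 * real (L i)) \<le> (\<Sum>i<K. real (t (Suc i) - t i) + real r)"
    by (intro sum_mono) auto
  also have "\<dots> = real (t K) + K * real r"
    using sum_cut_points[OF t(1), of "\<lambda>_. 1" K] by (simp add: sum.distrib t(2))
  finally have front: "2 * (\<Sum>i<K. real (L i)) \<le> real (t K) + K * real r"
    by (simp add: sum_distrib_left)
  have "(\<Sum>x\<in>{t K..<t (Suc K)}. occ (A_prefix q r n) (c K) x) \<le> (\<Sum>x\<in>{t K..<t (Suc K)}. 1)"
    by (intro sum_mono occ_le_1)
  then have "real (L K) \<le> real (t (Suc K) - t K)" using L[of K] by simp
  then have "real (L K) \<le> real n - real (t K)"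
    using t(3) t_mono[of K "Suc K"] by (simp add: of_nat_diff)
  \<comment> \<open>The truncated last run is bounded once by its piece and once by its own length,
    so twice \<open>L K\<close> costs no further error \<open>r\<close>.\<close>
  moreover have "real (L K) \<le> real (n mod r')" using L[of K] by (simp add: len_def)
  ultimately have "2 * (\<Sum>i<Suc K. real (L i)) \<le> real n + K * real r + real (n mod r')"
    using front by simp
  then have "2 * real (length s) \<le> real n + K * real r + real (n mod r')"
    unfolding s by simp
  moreover have "real n = real K * real r' + real (n mod r')"
    unfolding K_def of_nat_mult[symmetric] of_nat_add[symmetric] by (subst div_mult_mod_eq) simp
  ultimately have "real (2 * length s + K * r') \<le> real (2 * n + K * r)" by simp
  then show ?thesis unfolding K_def using of_nat_le_iff by blast
qed

section \<open>Averages over cells\<close>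

text \<open>The conditional expectation of \<open>f\<close> for the partition into blocks of length
  \<open>l\<close>.\<close>

definition cell_mean :: "nat \<Rightarrow> (nat \<Rightarrow> real) \<Rightarrow> nat \<Rightarrow> real" where
  "cell_mean l f x = (\<Sum>y\<in>{x div l * l..<x div l * l + l}. f y) / l"

text \<open>The error \<open>f - cell_mean l f\<close> sums to zero on each cell, so it is
  orthogonal to functions constant on cells.\<close>

lemma sum_cell_mean_mult:
  assumes "l > 0" "l dvd M" "\<And>x y. x div l = y div l \<Longrightarrow> g x = g y"
  shows "(\<Sum>x<M. cell_mean l f x * g x) = (\<Sum>x<M. f x * g x)"
proof -
  have "(\<Sum>x<k * l. cell_mean l f x * g x) = (\<Sum>x<k * l. f x * g x)" for k
  proof (induction k)
    case (Suc k)
    have split: "(\<Sum>x<Suc k * l. h x) = (\<Sum>x<k * l. h x) + (\<Sum>x\<in>{k * l..<k * l + l}. h x)"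
      for h :: "nat \<Rightarrow> real"
      using sum.atLeastLessThan_concat[of 0 "k * l" "k * l + l" h]
      by (simp add: atLeast0LessThan add.commute)
    have cell: "x div l = k" if "x \<in> {k * l..<k * l + l}" for x
      using that assms(1) by (intro div_nat_eqI) (auto simp: algebra_simps)
    define S where "S = (\<Sum>y\<in>{k * l..<k * l + l}. f y)"
    have g: "g x = g (k * l)" if "x \<in> {k * l..<k * l + l}" for x
      using assms(3)[of x "k * l"] cell[OF that] assms(1) by simp
    have "(\<Sum>x\<in>{k * l..<k * l + l}. cell_mean l f x * g x) = (\<Sum>x\<in>{k * l..<k * l + l}. S / l * g (k * l))"
      by (intro sum.cong refl) (simp only: cell_mean_def cell g S_def)
    also have "\<dots> = S * g (k * l)" using assms(1) by simp
    also have "\<dots> = (\<Sum>x\<in>{k * l..<k * l + l}. f x * g (k * l))"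
      by (simp only: S_def sum_distrib_right)
    also have "\<dots> = (\<Sum>x\<in>{k * l..<k * l + l}. f x * g x)"
    proof (intro sum.cong refl)
      fix x assume "x \<in> {k * l..<k * l + l}"
      from g[OF this] show "f x * g (k * l) = f x * g x" by simp
    qed
    finally show ?case using Suc by (simp only: split)
  qed simp
  from this[of "M div l"] show ?thesis using assms(2) by simp
qed

lemma cell_mean_cong: "x div l = y div l \<Longrightarrow> cell_mean l f x = cell_mean l f y"
  by (simp add: cell_mean_def)

lemma div_eq_of_dvd: "l dvd h \<Longrightarrow> x div l = y div l \<Longrightarrow> x div h = y div (h :: nat)"
  by (metis div_mult2_eq dvd_def)

text \<open>Pythagoras for nested cells: the coarse mean is the orthogonal projection of the fine
  one, so the mixed term equals the coarse square sum.\<close>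

lemma sum_cell_mean_diff_square:
  assumes "l > 0" "h > 0" "l dvd h" "h dvd M"
  shows "(\<Sum>x<M. (cell_mean l f x - cell_mean h f x)\<^sup>2) =
    (\<Sum>x<M. (cell_mean l f x)\<^sup>2) - (\<Sum>x<M. (cell_mean h f x)\<^sup>2)"
proof -
  have "(\<Sum>x<M. cell_mean l f x * cell_mean h f x) = (\<Sum>x<M. f x * cell_mean h f x)"
    using assms by (intro sum_cell_mean_mult cell_mean_cong) (auto intro: dvd_trans div_eq_of_dvd)
  also have "\<dots> = (\<Sum>x<M. cell_mean h f x * cell_mean h f x)"
    using assms by (intro sum_cell_mean_mult[symmetric] cell_mean_cong) auto
  finally have mixed: "(\<Sum>x<M. cell_mean l f x * cell_mean h f x) = (\<Sum>x<M. (cell_mean h f x)\<^sup>2)"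
    by (simp add: power2_eq_square)
  have "(\<Sum>x<M. (cell_mean l f x - cell_mean h f x)\<^sup>2) = (\<Sum>x<M. (cell_mean l f x)\<^sup>2)
      + (\<Sum>x<M. (cell_mean h f x)\<^sup>2) - 2 * (\<Sum>x<M. cell_mean l f x * cell_mean h f x)"
    by (simp add: power2_diff sum.distrib sum_subtractf sum_distrib_left mult.assoc)
  then show ?thesis using mixed by simp
qed

lemma cell_mean_bounds:
  assumes "l > 0" "\<And>x. 0 \<le> f x" "\<And>x. f x \<le> 1"
  shows "0 \<le> cell_mean l f x" "cell_mean l f x \<le> 1"
proof -
  have "(\<Sum>y\<in>{x div l * l..<x div l * l + l}. f y) \<le> (\<Sum>y\<in>{x div l * l..<x div l * l + l}. 1)"
    by (intro sum_mono assms)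
  then show "cell_mean l f x \<le> 1" using assms(1) by (simp add: cell_mean_def)
  show "0 \<le> cell_mean l f x" by (auto simp: cell_mean_def intro!: divide_nonneg_nonneg sum_nonneg assms)
qed

text \<open>Complete cells cancel; the at most \<open>l - 1\<close> positions of the last incomplete
  one contribute at most 1 each. The exact \<open>l - 1\<close> matters: for short runs the fine
  scale is \<open>l = 1\<close>, where the error vanishes.\<close>

lemma cell_mean_prefix_discrepancy:
  assumes "l > 0" "\<And>x. 0 \<le> f x" "\<And>x. f x \<le> 1"
  shows "\<bar>(\<Sum>x<b. f x - cell_mean l f x)\<bar> \<le> real (l - 1)"
proof -
  define a where "a = b div l * l"
  have ab: "a \<le> b" "b - a \<le> l - 1"
    using assms(1) mod_less_divisor[OF assms(1), of b] by (auto simp: a_def minus_div_mult_eq_mod)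
  have "(\<Sum>x<a. f x - cell_mean l f x) = 0"
    using sum_cell_mean_mult[of l a "\<lambda>_. 1" f] assms(1) by (simp add: a_def sum_subtractf)
  then have "(\<Sum>x<b. f x - cell_mean l f x) = (\<Sum>x\<in>{a..<b}. f x - cell_mean l f x)"
    using sum.atLeastLessThan_concat[of 0 a b "\<lambda>x. f x - cell_mean l f x"] ab(1)
    by (simp add: atLeast0LessThan)
  also have "\<bar>\<dots>\<bar> \<le> (\<Sum>x\<in>{a..<b}. \<bar>f x - cell_mean l f x\<bar>)" by (rule sum_abs)
  also have "\<dots> \<le> (\<Sum>x\<in>{a..<b}. 1)"
    using cell_mean_bounds[OF assms(1), of f] assms(2,3)
    by (intro sum_mono) (smt (verit))
  finally show ?thesis using ab(2) by simp
qed

lemma cell_mean_interval_discrepancy: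
  assumes "l > 0" "\<And>x. 0 \<le> f x" "\<And>x. f x \<le> 1" "a \<le> b"
  shows "(\<Sum>x\<in>{a..<b}. f x) \<le> (\<Sum>x\<in>{a..<b}. cell_mean l f x) + 2 * real (l - 1)"
proof -
  have "(\<Sum>x\<in>{a..<b}. f x - cell_mean l f x) =
      (\<Sum>x<b. f x - cell_mean l f x) - (\<Sum>x<a. f x - cell_mean l f x)"
    using sum.atLeastLessThan_concat[of 0 a b "\<lambda>x. f x - cell_mean l f x"] assms(4)
    by (simp add: atLeast0LessThan)
  then show ?thesis
    using cell_mean_prefix_discrepancy[of l f a, OF assms(1-3)]
      cell_mean_prefix_discrepancy[of l f b, OF assms(1-3)]
    by (simp add: sum_subtractf)
qed

lemma sum_occ_le_1:
  assumes "finite C" shows "(\<Sum>c\<in>C. occ v c x) \<le> 1"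
proof -
  have "(\<Sum>c\<in>C. occ v c x) \<le> (\<Sum>c\<in>C. if c = v ! x then 1 else 0)"
    by (rule sum_mono) (auto simp: occ_def)
  also have "\<dots> \<le> 1" using assms by simp
  finally show ?thesis .
qed

lemma sum_cell_mean_occ_le_1:
  assumes "finite C" "l > 0"
  shows "(\<Sum>c\<in>C. cell_mean l (occ v c) x) \<le> 1"
proof -
  have "(\<Sum>c\<in>C. cell_mean l (occ v c) x) = cell_mean l (\<lambda>y. \<Sum>c\<in>C. occ v c y) x"
    unfolding cell_mean_def by (subst sum.swap) (simp add: sum_divide_distrib[symmetric])
  also have "\<dots> \<le> 1"
    using assms by (intro cell_mean_bounds) (auto intro: sum_nonneg occ_nonneg sum_occ_le_1)
  finally show ?thesis .
qed

section \<open>Gain of a single run\<close>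

text \<open>The best gain per unit of run length at density \<open>p\<close>: a matched symbol earns
  \<open>2 z + 1\<close> and uses up \<open>1 / p\<close> positions of \<open>v\<close>; where this
  does not pay, nothing is gained.\<close>

definition slope :: "nat \<Rightarrow> real \<Rightarrow> real" where
  "slope z p = (if 1 \<le> (2 * real z + 1) * p then 2 * real z + 1 - 1 / p else 0)"

text \<open>Matching \<open>L\<close> symbols up to an error \<open>e\<close> takes
  \<open>w \<ge> (L - e) / p\<close> positions, and \<open>1 / p \<le> 2 z + 1\<close> when matching
  pays. Otherwise \<open>w\<close> outweighs what the density \<open>p\<close> yields.\<close>

lemma run_gain:
  assumes "0 \<le> p" "0 \<le> e" "0 \<le> L" "L \<le> r" "L \<le> p * w + e" "0 \<le> w"
  shows "(2 * real z + 1) * L - w \<le> r * slope z p + (2 * real z + 1) * e"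
proof (cases "1 \<le> (2 * real z + 1) * p")
  case True
  then have p: "p > 0" using assms(1) by (cases "p = 0") auto
  then have inv: "1 / p \<le> 2 * real z + 1" using True by (simp add: field_simps)
  have "L / p \<le> w + e / p" using assms(5) p by (simp add: field_simps)
  then have "(2 * real z + 1) * L - w \<le> L * (2 * real z + 1 - 1 / p) + e * (1 / p)"
    by (simp add: algebra_simps)
  also have "\<dots> \<le> r * (2 * real z + 1 - 1 / p) + e * (2 * real z + 1)"
    using assms inv by (intro add_mono mult_right_mono mult_left_mono) auto
  finally show ?thesis using True by (simp add: slope_def mult.commute)
next
  case False
  have "(2 * real z + 1) * L \<le> ((2 * real z + 1) * p) * w + (2 * real z + 1) * e"
    using mult_left_mono[OF assms(5), of "2 * real z + 1"] by (simp add: algebra_simps)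
  also have "\<dots> \<le> 1 * w + (2 * real z + 1) * e"
    using False assms(6) by (intro add_right_mono mult_right_mono) auto
  finally show ?thesis using False by (simp add: slope_def)
qed

text \<open>By convexity of \<open>1 / p\<close>, the sum is at most \<open>k (2 z + 1 - k)\<close> for \<open>k\<close> the number of
  nonzero terms; among integers \<open>k\<close> this is maximal at \<open>k = z\<close> and \<open>k = z + 1\<close>.\<close>
lemma sum_slope_le:
  assumes "finite C" "\<And>c. c \<in> C \<Longrightarrow> 0 \<le> p c" "(\<Sum>c\<in>C. p c) \<le> 1"
  shows "(\<Sum>c\<in>C. slope z (p c)) \<le> real z * (real z + 1)"
proof -
  define B where "B = {c\<in>C. 1 \<le> (2 * real z + 1) * p c}"
  define k where "k = real (card B)"
  have "(\<Sum>c\<in>C. slope z (p c)) = (\<Sum>c\<in>B. 2 * real z + 1 - 1 / p c)"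
    unfolding B_def using assms(1) by (subst sum.inter_filter) (auto simp: slope_def intro!: sum.cong)
  \<comment> \<open>The tangent of the convex function \<open>1 / p\<close> at
    \<open>p = 1 / k\<close>, the case of \<open>k\<close> equal densities.\<close>
  also have "\<dots> \<le> (\<Sum>c\<in>B. 2 * real z + 1 - (2 * k - k\<^sup>2 * p c))"
  proof (intro sum_mono diff_left_mono)
    fix c assume "c \<in> B"
    then have "p c > 0" using assms(2)[of c] by (cases "p c = 0") (auto simp: B_def)
    moreover have "0 \<le> (k * p c - 1)\<^sup>2" by simp
    ultimately show "2 * k - k\<^sup>2 * p c \<le> 1 / p c"
      by (simp add: field_simps power2_eq_square)
  qed
  also have "\<dots> = k * (2 * real z + 1) - (2 * k\<^sup>2 - k\<^sup>2 * (\<Sum>c\<in>B. p c))"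
  proof -
    have "(\<Sum>c\<in>B. 2 * real z + 1 - (2 * k - k\<^sup>2 * p c)) = (\<Sum>c\<in>B. (2 * real z + 1 - 2 * k) + k\<^sup>2 * p c)"
      by (simp add: algebra_simps)
    also have "\<dots> = k * (2 * real z + 1 - 2 * k) + k\<^sup>2 * (\<Sum>c\<in>B. p c)"
      by (simp add: sum.distrib sum_distrib_left k_def)
    finally show ?thesis by (simp add: algebra_simps power2_eq_square)
  qed
  also have "\<dots> \<le> k * (2 * real z + 1) - k\<^sup>2"
  proof -
    have "(\<Sum>c\<in>B. p c) \<le> (\<Sum>c\<in>C. p c)"
      using assms by (intro sum_mono2) (auto simp: B_def)
    then have "k\<^sup>2 * (\<Sum>c\<in>B. p c) \<le> k\<^sup>2 * 1" using assms(3) by (intro mult_left_mono) auto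
    then show ?thesis by simp
  qed
  also have "\<dots> \<le> real z * (real z + 1)"
  proof -
    \<comment> \<open>A product of two consecutive integers is nonnegative; this is where the
      integrality of \<open>k\<close> enters.\<close>
    have "0 \<le> (int (card B) - int z) * (int (card B) - int z - 1)"
      by (cases "card B \<le> z") (auto simp: zero_le_mult_iff)
    then have "0 \<le> real_of_int ((int (card B) - int z) * (int (card B) - int z - 1))" by linarith
    then show ?thesis by (simp add: k_def power2_eq_square algebra_simps)
  qed
  finally show ?thesis .
qed

section \<open>Run lengths in a window\<close>

text \<open>Exponents whose powers lie in a window of ratio \<open>W\<close> differ by at most
  \<open>ln W / ln b\<close>. The window constrains the powers before rounding, so its users have to
  make room for the floor.\<close>

lemma card_powers_in_window:
  fixes b y W :: real
  assumes "b > 1" "y > 0" "W \<ge> 1" "\<And>r. r \<in> R \<Longrightarrow> \<exists>k. r = nat \<lfloor>b ^ k\<rfloor> \<and> y \<le> b ^ k \<and> b ^ k \<le> W * y"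
  shows "real (card R) \<le> 1 + ln W / ln b"
proof -
  define Kset where "Kset = {k. y \<le> b ^ k \<and> b ^ k \<le> W * y}"
  define k0 where "k0 = (LEAST k. k \<in> Kset)"
  define B where "B = nat \<lfloor>ln W / ln b\<rfloor>"
  have lnb: "ln b > 0" using assms(1) by simp
  have bound: "k \<in> {k0..k0 + B}" if "k \<in> Kset" for k
  proof -
    have k0: "k0 \<in> Kset" "k0 \<le> k" unfolding k0_def using that by (auto intro: LeastI Least_le)
    have "b ^ k \<le> W * b ^ k0" using that k0(1) assms(3) by (auto simp: Kset_def intro: order_trans mult_left_mono)
    then have "ln (b ^ k) \<le> ln (W * b ^ k0)" using assms by (subst ln_le_cancel_iff) auto
    then have "real k * ln b \<le> ln W + real k0 * ln b"
      using assms by (simp add: ln_mult ln_realpow)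
    then have "real k - real k0 \<le> ln W / ln b" using lnb by (simp add: field_simps)
    then have "int k - int k0 \<le> \<lfloor>ln W / ln b\<rfloor>" by (simp add: le_floor_iff)
    then show ?thesis using k0(2) by (auto simp: B_def)
  qed
  then have fin: "finite Kset" by (meson finite_atLeastAtMost finite_subset subsetI)
  have "R \<subseteq> (\<lambda>k. nat \<lfloor>b ^ k\<rfloor>) ` Kset" using assms(4) by (auto simp: Kset_def)
  then have "card R \<le> card Kset" using fin by (rule surj_card_le[rotated])
  also have "\<dots> \<le> card {k0..k0 + B}" using bound by (intro card_mono) auto
  finally have "card R \<le> Suc B" by simp
  moreover have "ln W / ln b \<ge> 0" using assms lnb by simp
  then have "real B \<le> ln W / ln b" by (simp add: B_def)
  ultimately show "real (card R) \<le> 1 + ln W / ln b" by linarith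
qed

section \<open>Energy drop forced by one codeword\<close>

text \<open>The squared norm of all symbol densities at scale \<open>l\<close>, used as a potential.
  \<open>M\<close> is meant to be a common multiple of all scales that reaches past the end of
  \<open>v\<close>.\<close>

definition energy :: "'a set \<Rightarrow> 'a list \<Rightarrow> nat \<Rightarrow> nat \<Rightarrow> real" where
  "energy C v M l = (\<Sum>c\<in>C. \<Sum>x<M. (cell_mean l (occ v c) x)\<^sup>2)"

lemma energy_diff:
  assumes "l > 0" "h > 0" "l dvd h" "h dvd M"
  shows "(\<Sum>x<M. \<Sum>c\<in>C. (cell_mean l (occ v c) x - cell_mean h (occ v c) x)\<^sup>2) =
    energy C v M l - energy C v M h"
  by (subst sum.swap) (simp add: energy_def sum_cell_mean_diff_square[OF assms] sum_subtractf)

lemma energy_antimono: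
  assumes "l > 0" "h > 0" "l dvd h" "h dvd M"
  shows "energy C v M h \<le> energy C v M l"
proof -
  have "0 \<le> energy C v M l - energy C v M h"
    unfolding energy_diff[OF assms, symmetric] by (intro sum_nonneg) auto
  then show ?thesis by simp
qed

lemma energy_nonneg: "0 \<le> energy C v M l"
  by (auto simp: energy_def intro!: sum_nonneg)

text \<open>At scale 1 the densities are indicators, equal to their squares, and each position
  carries at most one symbol.\<close>

lemma energy_one_le:
  assumes "finite C" "length v \<le> M"
  shows "energy C v M 1 \<le> length v"
proof -
  have "energy C v M 1 = (\<Sum>x<M. \<Sum>c\<in>C. occ v c x)"
    unfolding energy_def
    by (subst sum.swap) (auto simp: cell_mean_def occ_def intro!: sum.cong)
  also have "\<dots> = (\<Sum>x<length v. \<Sum>c\<in>C. occ v c x)"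
    using assms(2) by (intro sum.mono_neutral_right) (auto simp: occ_def)
  also have "\<dots> \<le> (\<Sum>x<length v. 1)"
    by (intro sum_mono sum_occ_le_1 assms)
  finally show ?thesis by simp
qed

text \<open>One period of runs \<open>I\<^sub>0, \<dots>, I\<^sub>q\<^sub>-\<^sub>1\<close> of the codeword. If the part of \<open>v\<close> matched to it lies in one
  cell of length \<open>h\<close>, the coarse densities are constant on it; otherwise the trivial bound is paid
  for by the crossed cell boundary.\<close>
lemma period_gain:
  fixes t L :: "nat \<Rightarrow> nat" and \<alpha> :: real
  assumes "mono t" "0 < l" "0 < h" "0 < \<alpha>"
    and L: "\<And>i. i < q \<Longrightarrow> L i \<le> r \<and> real (L i) \<le> (\<Sum>x\<in>{t i..<t (Suc i)}. occ v (i + 1) x)"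
  defines "w \<equiv> \<lambda>x. \<alpha> + (\<Sum>c\<in>{1..q}. (cell_mean l (occ v c) x - cell_mean h (occ v c) x)\<^sup>2) / (4 * \<alpha>)"
  shows "(\<Sum>i<q. (2 * real z + 1) * L i - (real (t (Suc i)) - real (t i))) \<le>
    r * (real z * (real z + 1)) + (2 * real z + 1) * ((\<Sum>x\<in>{t 0..<t q}. w x) + 2 * real q * real (l - 1))
      + (2 * real z + 1) * q * r * (real (t q div h) - real (t 0 div h))"
proof -
  have t_mono: "t i \<le> t j" if "i \<le> j" for i j using monoD[OF assms(1) that] .
  have w_nonneg: "0 \<le> w x" for x
    using assms(4) unfolding w_def by (intro add_nonneg_nonneg divide_nonneg_nonneg sum_nonneg) auto
  show ?thesis
  proof (cases "t 0 div h = t q div h")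
    case True
    define p where "p = (\<lambda>c. cell_mean h (occ v c) (t 0))"
    define e where "e = (\<lambda>i. (\<Sum>x\<in>{t i..<t (Suc i)}. w x) + 2 * real (l - 1))"
    have gain: "(2 * real z + 1) * L i - (real (t (Suc i)) - real (t i)) \<le>
        r * slope z (p (i + 1)) + (2 * real z + 1) * e i" if "i < q" for i
    proof (rule run_gain)
      show "0 \<le> p (i + 1)" unfolding p_def
        by (rule cell_mean_bounds[OF assms(3)]) (auto simp: occ_nonneg occ_le_1)
      show "0 \<le> e i" unfolding e_def by (intro add_nonneg_nonneg sum_nonneg w_nonneg) auto
      show "0 \<le> real (t (Suc i)) - real (t i)" using t_mono[of i "Suc i"] by simp
      show "real (L i) \<le> r" using L[OF that] by simp
      have coarse: "cell_mean l (occ v (i + 1)) x \<le> p (i + 1) + w x" if x: "x \<in> {t i..<t (Suc i)}" for x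
      proof -
        define d where "d = cell_mean l (occ v (i + 1)) x - cell_mean h (occ v (i + 1)) x"
        have "t 0 \<le> x" "x \<le> t q"
          using x t_mono[of 0 i] t_mono[of "Suc i" q] \<open>i < q\<close> by auto
        then have "x div h = t 0 div h" using True div_le_mono[of "t 0" x h] div_le_mono[of x "t q" h] by simp
        then have "cell_mean h (occ v (i + 1)) x = p (i + 1)" unfolding p_def by (rule cell_mean_cong)
        \<comment> \<open>A linearised Cauchy-Schwarz inequality: a bound linear in
          \<open>d\<^sup>2\<close> can be summed over positions to an energy difference.\<close>
        moreover have "d \<le> \<alpha> + d\<^sup>2 / (4 * \<alpha>)"
        proof -
          have "0 \<le> (d - 2 * \<alpha>)\<^sup>2" by simp
          then show ?thesis using assms(4) by (simp add: field_simps power2_eq_square)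
        qed
        \<comment> \<open>Passing to the sum over all symbols makes the error \<open>w\<close> the
          same for every run.\<close>
        moreover have "d\<^sup>2 \<le> (\<Sum>c\<in>{1..q}. (cell_mean l (occ v c) x - cell_mean h (occ v c) x)\<^sup>2)"
          unfolding d_def using \<open>i < q\<close>
          by (intro member_le_sum[where f = "\<lambda>c. (cell_mean l (occ v c) x - cell_mean h (occ v c) x)\<^sup>2"]) auto
        then have "d\<^sup>2 / (4 * \<alpha>) \<le> (\<Sum>c\<in>{1..q}. (cell_mean l (occ v c) x - cell_mean h (occ v c) x)\<^sup>2) / (4 * \<alpha>)"
          using assms(4) by (intro divide_right_mono) auto
        ultimately show ?thesis unfolding w_def d_def by linarith
      qed
      have "real (L i) \<le> (\<Sum>x\<in>{t i..<t (Suc i)}. occ v (i + 1) x)" using L[OF that] by simp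
      also have "\<dots> \<le> (\<Sum>x\<in>{t i..<t (Suc i)}. cell_mean l (occ v (i + 1)) x) + 2 * real (l - 1)"
        by (rule cell_mean_interval_discrepancy[OF assms(2)])
          (use t_mono[of i "Suc i"] in \<open>auto simp: occ_nonneg occ_le_1\<close>)
      also have "(\<Sum>x\<in>{t i..<t (Suc i)}. cell_mean l (occ v (i + 1)) x)
          \<le> (\<Sum>x\<in>{t i..<t (Suc i)}. p (i + 1) + w x)"
        by (rule sum_mono[OF coarse])
      also have "\<dots> = p (i + 1) * (real (t (Suc i)) - real (t i)) + (\<Sum>x\<in>{t i..<t (Suc i)}. w x)"
        using t_mono[of i "Suc i"] by (simp add: sum.distrib of_nat_diff)
      finally show "real (L i) \<le> p (i + 1) * (real (t (Suc i)) - real (t i)) + e i"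
        by (simp add: e_def)
    qed simp
    have "(\<Sum>i<q. (2 * real z + 1) * L i - (real (t (Suc i)) - real (t i)))
        \<le> (\<Sum>i<q. r * slope z (p (i + 1)) + (2 * real z + 1) * e i)"
      by (intro sum_mono gain) auto
    also have "\<dots> = r * (\<Sum>i<q. slope z (p (i + 1))) + (2 * real z + 1) * (\<Sum>i<q. e i)"
      by (simp add: sum.distrib sum_distrib_left)
    also have "(\<Sum>i<q. slope z (p (i + 1))) = (\<Sum>c\<in>{1..q}. slope z (p c))"
      by (rule sum.reindex_bij_witness[of _ "\<lambda>c. c - 1" "\<lambda>i. i + 1"]) auto
    also have "(\<Sum>i<q. e i) = (\<Sum>x\<in>{t 0..<t q}. w x) + 2 * real q * real (l - 1)"
      by (simp add: e_def sum.distrib sum_cut_points[OF assms(1)])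
    also have "r * (\<Sum>c\<in>{1..q}. slope z (p c)) \<le> r * (real z * (real z + 1))"
    proof (intro mult_left_mono sum_slope_le)
      fix c show "0 \<le> p c" unfolding p_def
        by (rule cell_mean_bounds[OF assms(3)]) (auto simp: occ_nonneg occ_le_1)
    qed (use assms(3) in \<open>auto simp: p_def intro: sum_cell_mean_occ_le_1\<close>)
    finally show ?thesis using True by simp
  next
    case False
    then have crossed: "1 \<le> real (t q div h) - real (t 0 div h)"
      using div_le_mono[OF t_mono[of 0 q], of h] by simp
    have "(2 * real z + 1) * L i - (real (t (Suc i)) - real (t i)) \<le> (2 * real z + 1) * r" if "i < q" for i
    proof -
      have "(2 * real z + 1) * L i \<le> (2 * real z + 1) * r"
        using L[OF that] by (intro mult_left_mono) auto
      moreover have "real (t i) \<le> real (t (Suc i))" using t_mono[of i "Suc i"] by simp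
      ultimately show ?thesis by linarith
    qed
    then have "(\<Sum>i<q. (2 * real z + 1) * L i - (real (t (Suc i)) - real (t i))) \<le> (\<Sum>i<q. (2 * real z + 1) * r)"
      by (intro sum_mono) auto
    also have "\<dots> = (2 * real z + 1) * q * r * 1" by simp
    also have "\<dots> \<le> (2 * real z + 1) * q * r * (real (t q div h) - real (t 0 div h))"
      by (intro mult_left_mono crossed) auto
    finally have "(\<Sum>i<q. (2 * real z + 1) * L i - (real (t (Suc i)) - real (t i))) \<le> \<dots>" .
    moreover have "0 \<le> (\<Sum>x\<in>{t 0..<t q}. w x)" by (intro sum_nonneg w_nonneg)
    then have "0 \<le> r * (real z * (real z + 1)) +
        (2 * real z + 1) * ((\<Sum>x\<in>{t 0..<t q}. w x) + 2 * real q * real (l - 1))"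
      by (intro add_nonneg_nonneg mult_nonneg_nonneg) auto
    ultimately show ?thesis by linarith
  qed
qed

text \<open>After summing \<open>period_gain\<close> over all periods, the excess
  \<open>\<epsilon> n z\<close> has to be covered by errors: the incomplete period,
  \<open>w\<close>, rounding at scale \<open>l\<close>, and cell boundaries at scale
  \<open>h\<close>. The size conditions keep all but the energy part of \<open>w\<close>
  small.\<close>

lemma energy_increment:
  fixes \<epsilon> :: real
  assumes q: "0 < q" and z: "1 \<le> z" "z \<le> q" and r: "0 < r" and \<epsilon>: "0 < \<epsilon>" "\<epsilon> < 1"
    and s: "subseq s (A_prefix q r n)" "subseq s v"
    and gain: "n * (real z * (real z + 1)) / q + \<epsilon> * n * z \<le> (2 * real z + 1) * length s - length v"
    and v: "length v \<le> q * n" "length v \<le> M"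
    and rn: "24 * real q * r \<le> \<epsilon> * n"
    and l: "0 < l" "96 * real (l - 1) \<le> \<epsilon> * r"
    and h: "24 * (real q)\<^sup>2 * r \<le> \<epsilon> * h" "l dvd h" "h dvd M"
  shows "\<epsilon>\<^sup>2 * n \<le> 24 * real q * (energy {1..q} v M l - energy {1..q} v M h)"
proof -
  define Z where "Z = 2 * real z + 1"
  \<comment> \<open>With \<open>m \<le> q n\<close>, the constant part of \<open>w\<close> then adds
    up to at most \<open>\<epsilon> n / 12\<close>.\<close>
  define \<alpha> where "\<alpha> = \<epsilon> / (12 * q)"
  \<comment> \<open>Enough whole periods to cover length \<open>n\<close>, overshooting by at most
    \<open>q r\<close>. The successor also ensures that there is a run, so that the last cut is
    \<open>m\<close>.\<close>
  define G where "G = Suc (n div (q * r))"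
  define m where "m = length v"
  define w where "w = (\<lambda>x. \<alpha> + (\<Sum>c\<in>{1..q}. (cell_mean l (occ v c) x - cell_mean h (occ v c) x)\<^sup>2) / (4 * \<alpha>))"
  define \<Delta> where "\<Delta> = energy {1..q} v M l - energy {1..q} v M h"
  have \<alpha>: "0 < \<alpha>" using q \<epsilon> by (simp add: \<alpha>_def)
  have "0 < 24 * (real q)\<^sup>2 * r" using q r by simp
  then have "0 < \<epsilon> * h" using h(1) by linarith
  then have h0: "0 < h" using \<epsilon> by (simp add: zero_less_mult_iff)
  have G_lower: "n \<le> G * q * r"
  proof -
    have "n \<le> n div (q * r) * (q * r) + q * r"
      using div_mult_mod_eq[of n "q * r"] mod_less_divisor[of "q * r" n] q r
      by (metis add_left_mono less_imp_le nat_0_less_mult_iff)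
    then show ?thesis by (simp add: G_def algebra_simps)
  qed
  have G_upper: "real G * q * r \<le> n + q * r"
  proof -
    have "n div (q * r) * (q * r) \<le> n" by (rule div_times_less_eq_dividend)
    then have "G * q * r \<le> n + q * r" unfolding G_def by (simp add: algebra_simps)
    then show ?thesis by (metis (no_types, lifting) of_nat_add of_nat_le_iff of_nat_mult)
  qed
  define c where "c = (\<lambda>i. i mod q + 1)"
  have "subseq s (A_prefix q r (G * q * r))"
    using A_prefix_add[of q r n "G * q * r - n"] G_lower s(1) by (simp add: list_emb_append2 subseq_rev_drop_many)
  then have "subseq s (concat (map (\<lambda>i. replicate r (c i)) [0..<G * q]))"
    by (simp only: A_prefix_runs[OF r] c_def)
  from subseq_runs_cut_points[OF this s(2)] obtain t L where
    t: "mono t" "t 0 = 0" "t (G * q) = m" and sL: "length s = (\<Sum>i<G * q. L i)"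
    and L: "\<And>i. i < G * q \<Longrightarrow> L i \<le> r \<and> real (L i) \<le> (\<Sum>x\<in>{t i..<t (Suc i)}. occ v (c i) x)"
    using q by (auto simp: m_def G_def)
  define T where "T = (\<lambda>J. t (J * q))"
  have T: "mono T" unfolding T_def mono_def using t(1) by (simp add: mono_def)
  have period: "(\<Sum>i\<in>{J * q..<J * q + q}. Z * L i - (real (t (Suc i)) - real (t i))) \<le>
      r * (real z * (real z + 1)) + Z * ((\<Sum>x\<in>{T J..<T (Suc J)}. w x) + 2 * real q * real (l - 1))
      + Z * q * r * (real (T (Suc J) div h) - real (T J div h))" if "J < G" for J
  proof -
    have less: "J * q + i < G * q" if "i < q" for i
    proof -
      have "J * q + i < Suc J * q" using that by simp
      also have "\<dots> \<le> G * q" using \<open>J < G\<close> by (intro mult_right_mono) auto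
      finally show ?thesis .
    qed
    have "(\<Sum>i\<in>{J * q..<J * q + q}. Z * L i - (real (t (Suc i)) - real (t i))) =
        (\<Sum>i<q. Z * L (J * q + i) - (real (t (J * q + Suc i)) - real (t (J * q + i))))"
      by (rule sum.reindex_bij_witness[of _ "\<lambda>i. J * q + i" "\<lambda>i. i - J * q"]) auto
    also have "\<dots> \<le> r * (real z * (real z + 1)) +
        Z * ((\<Sum>x\<in>{t (J * q + 0)..<t (J * q + q)}. w x) + 2 * real q * real (l - 1))
        + Z * q * r * (real (t (J * q + q) div h) - real (t (J * q + 0) div h))"
      unfolding Z_def w_def
    proof (rule period_gain[where t = "\<lambda>i. t (J * q + i)" and L = "\<lambda>i. L (J * q + i)"])
      show "mono (\<lambda>i. t (J * q + i))" using t(1) by (simp add: mono_def)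
      show "L (J * q + i) \<le> r \<and> real (L (J * q + i)) \<le>
          (\<Sum>x\<in>{t (J * q + i)..<t (J * q + Suc i)}. occ v (i + 1) x)" if "i < q" for i
        using L[OF less[OF that]] that by (simp add: c_def)
    qed (use l h0 \<alpha> in auto)
    finally show ?thesis by (simp add: T_def add.commute)
  qed
  have "(\<Sum>i<G * q. Z * L i - (real (t (Suc i)) - real (t i))) =
      (\<Sum>J<G. \<Sum>i\<in>{J * q..<J * q + q}. Z * L i - (real (t (Suc i)) - real (t i)))"
    by (rule sum.nat_group[symmetric])
  also have "\<dots> \<le> (\<Sum>J<G. r * (real z * (real z + 1))
      + Z * ((\<Sum>x\<in>{T J..<T (Suc J)}. w x) + 2 * real q * real (l - 1))
      + Z * q * r * (real (T (Suc J) div h) - real (T J div h)))"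
    by (intro sum_mono period) auto
  also have "\<dots> = real G * (r * (real z * (real z + 1)))
      + Z * ((\<Sum>J<G. \<Sum>x\<in>{T J..<T (Suc J)}. w x) + real G * (2 * real q * real (l - 1)))
      + Z * q * r * (\<Sum>J<G. real (T (Suc J) div h) - real (T J div h))"
    by (simp add: sum.distrib sum_distrib_left[symmetric])
  \<comment> \<open>Crossed boundaries telescope over the periods, so at most \<open>m div h\<close>
    of them are paid for.\<close>
  also have "(\<Sum>J<G. real (T (Suc J) div h) - real (T J div h)) = real (m div h)"
    using sum_lessThan_telescope[of "\<lambda>J. real (T J div h)" G] t by (simp add: T_def)
  also have "(\<Sum>J<G. \<Sum>x\<in>{T J..<T (Suc J)}. w x) = (\<Sum>x<m. w x)"
    using sum_cut_points[OF T, of w G] t by (simp add: T_def atLeast0LessThan)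
  finally have upper: "(\<Sum>i<G * q. Z * L i - (real (t (Suc i)) - real (t i))) \<le>
      real G * (r * (real z * (real z + 1))) + Z * ((\<Sum>x<m. w x) + real G * (2 * real q * real (l - 1)))
      + Z * q * r * real (m div h)" .
  have lower: "(\<Sum>i<G * q. Z * L i - (real (t (Suc i)) - real (t i))) = Z * length s - m"
    using sum_lessThan_telescope[of "\<lambda>i. real (t i)" "G * q"] t
    by (simp add: sum_subtractf sL sum_distrib_left)
  have sum_w: "(\<Sum>x<m. w x) \<le> \<alpha> * m + \<Delta> / (4 * \<alpha>)"
  proof -
    have "(\<Sum>x<m. w x) = \<alpha> * m +
        (\<Sum>x<m. \<Sum>c\<in>{1..q}. (cell_mean l (occ v c) x - cell_mean h (occ v c) x)\<^sup>2) / (4 * \<alpha>)"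
      by (simp add: w_def sum.distrib sum_divide_distrib)
    also have "\<dots> \<le> \<alpha> * m +
        (\<Sum>x<M. \<Sum>c\<in>{1..q}. (cell_mean l (occ v c) x - cell_mean h (occ v c) x)\<^sup>2) / (4 * \<alpha>)"
      using v(2) \<alpha> by (intro add_left_mono divide_right_mono sum_mono2) (auto simp: m_def intro: sum_nonneg)
    finally show ?thesis unfolding energy_diff[OF l(1) h0 h(2,3)] \<Delta>_def .
  qed
  have Z: "0 < Z" "Z \<le> 3 * z" using z by (auto simp: Z_def)
  define X where "X = \<Delta> / (4 * \<alpha>)"
  \<comment> \<open>The terms in \<open>z (z + 1)\<close> cancel up to
    \<open>r z (z + 1) \<le> Z q r\<close>; then \<open>Z\<close> is divided out, and
    \<open>Z \<le> 3 z\<close> leaves \<open>\<epsilon> n / 3\<close>.\<close>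
  have main: "\<epsilon> * n / 3 \<le> q * r + \<alpha> * m + X + 2 * (real G * q * real (l - 1)) + q * r * real (m div h)"
  proof -
    have "real G * (r * (real z * (real z + 1))) \<le> (n / q + r) * (real z * (real z + 1))"
    proof -
      have "real G * r \<le> n / q + r" using G_upper q by (simp add: field_simps)
      then show ?thesis by (simp only: mult.assoc[symmetric]) (intro mult_right_mono, auto)
    qed
    moreover have "r * (real z * (real z + 1)) \<le> Z * (q * r)"
    proof -
      have "real z * (real z + 1) \<le> q * Z" using z by (intro mult_mono) (auto simp: Z_def)
      then have "r * (real z * (real z + 1)) \<le> r * (q * Z)" by (intro mult_left_mono) auto
      then show ?thesis by (simp add: mult_ac)
    qed
    moreover have "Z * (\<Sum>x<m. w x) \<le> Z * (\<alpha> * m + X)"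
      using sum_w Z unfolding X_def by (intro mult_left_mono) auto
    ultimately have "\<epsilon> * n * z \<le> Z * (q * r) + Z * (\<alpha> * m + X) + Z * (real G * (2 * real q * real (l - 1)))
        + Z * q * r * real (m div h)"
      using gain upper lower unfolding Z_def[symmetric] m_def[symmetric]
      by (simp add: algebra_simps add_divide_distrib)
    moreover have "Z * (\<epsilon> * n / 3) \<le> \<epsilon> * n * z"
      using mult_right_mono[OF Z(2), of "\<epsilon> * n / 3"] \<epsilon> by (simp add: mult_ac)
    ultimately have "Z * (\<epsilon> * n / 3) \<le>
        Z * (q * r + \<alpha> * m + X + 2 * (real G * q * real (l - 1)) + q * r * real (m div h))"
      by (simp add: algebra_simps)
    then show ?thesis using Z(1) by (simp only: mult_le_cancel_left_pos)
  qed
  have "\<alpha> * m \<le> \<epsilon> * n / 12"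
  proof -
    have "real m \<le> q * n" using v(1) unfolding m_def by (metis of_nat_le_iff of_nat_mult)
    then have "\<alpha> * m \<le> \<alpha> * (q * n)" using \<alpha> by (intro mult_left_mono) auto
    then show ?thesis using q by (simp add: \<alpha>_def)
  qed
  moreover have "2 * (real G * q * real (l - 1)) \<le> \<epsilon> * n / 24"
  proof -
    have "q * r \<le> real n" using rn \<epsilon> mult_right_mono[of \<epsilon> 1 "real n"] by simp
    then have "real G * q * r \<le> 2 * n" using G_upper by simp
    then have "\<epsilon> * (real G * q * r) \<le> \<epsilon> * (2 * n)" using \<epsilon> by (intro mult_left_mono) auto
    moreover have "(real G * q) * (96 * real (l - 1)) \<le> (real G * q) * (\<epsilon> * r)"
      using l(2) by (intro mult_left_mono) auto
    ultimately show ?thesis by (simp add: mult_ac)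
  qed
  moreover have "q * r * real (m div h) \<le> \<epsilon> * n / 24"
  proof -
    have "h * (m div h) \<le> q * n" using v(1) unfolding m_def by (meson le_trans times_div_less_eq_dividend)
    then have "real h * real (m div h) \<le> q * n" by (metis of_nat_le_iff of_nat_mult)
    then have "\<epsilon> * (real h * real (m div h)) \<le> \<epsilon> * (q * n)" using \<epsilon> by (intro mult_left_mono) auto
    moreover have "24 * (real q)\<^sup>2 * r * real (m div h) \<le> \<epsilon> * h * real (m div h)"
      using h(1) by (intro mult_right_mono) auto
    ultimately have "q * (24 * (q * r * real (m div h))) \<le> q * (\<epsilon> * n)"
      by (simp add: power2_eq_square mult_ac)
    then show ?thesis using q by simp
  qed
  \<comment> \<open>In units of \<open>\<epsilon> n / 24\<close>, the left side is 8 and the four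
    small errors are \<open>1 + 2 + 1 + 1\<close>, which leaves 3 for the energy.\<close>
  ultimately have "\<epsilon> * n / 8 \<le> X" using main rn by (simp add: algebra_simps)
  then have "\<epsilon> * (\<epsilon> * n / 8) \<le> \<epsilon> * X" using \<epsilon> by (intro mult_left_mono) auto
  moreover have "\<epsilon> * X = 3 * q * \<Delta>" using \<epsilon> q by (simp add: X_def \<alpha>_def)
  ultimately show ?thesis by (simp add: \<Delta>_def power2_eq_square)
qed

section \<open>Double counting over dyadic scales\<close>

lemma ex_power_of_2_between:
  fixes x :: real
  assumes "1 \<le> x"
  shows "\<exists>j. 2 ^ j \<le> x \<and> x < 2 ^ Suc j"
proof -
  have "1 \<le> nat \<lfloor>x\<rfloor>" using assms by linarith
  then obtain j where j: "2 ^ j \<le> nat \<lfloor>x\<rfloor>" "nat \<lfloor>x\<rfloor> < 2 ^ Suc j"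
    using ex_power_ivl1[of 2 "nat \<lfloor>x\<rfloor>"] by auto
  have "(2::real) ^ j \<le> real (nat \<lfloor>x\<rfloor>)" using j(1) by (metis of_nat_le_iff of_nat_numeral of_nat_power)
  moreover have "real (nat \<lfloor>x\<rfloor>) + 1 \<le> (2::real) ^ Suc j"
    using j(2) by (metis Suc_leI of_nat_Suc of_nat_le_iff of_nat_numeral of_nat_power add.commute)
  ultimately have "2 ^ j \<le> x \<and> x < 2 ^ Suc j" using assms by linarith
  then show ?thesis ..
qed

lemma ln_inverse_power4:
  fixes \<epsilon> :: real
  assumes "0 < \<epsilon>" "\<epsilon> < 1"
  shows "1 < 1 / \<epsilon> ^ 4" "ln (1 / \<epsilon> ^ 4) = 4 * ln (1 / \<epsilon>)" "1 - \<epsilon> \<le> ln (1 / \<epsilon>)"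
proof -
  show "1 < 1 / \<epsilon> ^ 4" using assms by (simp add: power_less_one_iff)
  show "ln (1 / \<epsilon> ^ 4) = 4 * ln (1 / \<epsilon>)" using assms by (simp add: ln_div ln_realpow)
  show "1 - \<epsilon> \<le> ln (1 / \<epsilon>)" using assms ln_le_minus_one[of \<epsilon>] by (simp add: ln_div)
qed

text \<open>The ratio \<open>9216 q^2 / \<epsilon>^2\<close> is that of run lengths sharing a dyadic
  scale, with a factor 2 for rounding. The part \<open>2 ln (1 / \<epsilon>)\<close> of its
  logarithm is half of the denominator \<open>4 ln (1 / \<epsilon>)\<close>; the rest is divided by
  at least \<open>1 / (2 q)\<close>, because
  \<open>ln (1 / \<epsilon>) \<ge> 1 - \<epsilon>\<close>.\<close>

lemma window_bound:
  fixes \<epsilon> :: real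
  assumes "q \<ge> 2" "0 < \<epsilon>" "\<epsilon> < 1" "1 \<le> 8 * q * (1 - \<epsilon>)"
  shows "1 + ln (9216 * (real q)\<^sup>2 / \<epsilon>\<^sup>2) / ln (1 / \<epsilon> ^ 4) \<le> 20 * (real q)\<^sup>2"
proof -
  define \<tau> where "\<tau> = ln (1 / \<epsilon>)"
  have "1 / (8 * q) \<le> 1 - \<epsilon>" using assms by (simp add: field_simps)
  then have \<tau>: "1 / (8 * q) \<le> \<tau>"
    using ln_inverse_power4(3)[OF assms(2,3)] by (simp add: \<tau>_def)
  moreover have "0 < 1 / (8 * real q)" using assms by simp
  ultimately have \<tau>0: "0 < \<tau>" by linarith
  have "ln (9216::real) \<le> ln (2 ^ 14)" by (subst ln_le_cancel_iff) auto
  also have "\<dots> = 14 * ln (2::real)" by (subst ln_realpow) auto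
  also have "\<dots> \<le> 14" using ln_le_minus_one[of "2::real"] by simp
  finally have ln9216: "ln (9216::real) \<le> 14" .
  have lnq: "ln (real q) \<le> q" "0 \<le> ln (real q)" using assms(1) ln_le_minus_one[of "real q"] by auto
  have "9216 * (real q)\<^sup>2 / \<epsilon>\<^sup>2 = 9216 * (real q)\<^sup>2 * (1 / \<epsilon>)\<^sup>2" by (simp add: power_divide)
  also have "ln \<dots> = ln 9216 + 2 * ln (real q) + 2 * \<tau>"
    using assms by (simp add: ln_mult ln_realpow \<tau>_def del: One_nat_def)
  finally have lnW: "ln (9216 * (real q)\<^sup>2 / \<epsilon>\<^sup>2) = ln 9216 + 2 * ln (real q) + 2 * \<tau>" .
  have "(ln 9216 + 2 * ln (real q)) \<le> 14 + 2 * real q" using ln9216 lnq by simp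
  also have "\<dots> \<le> (14 + 2 * real q) * (8 * q * \<tau>)"
    using \<tau> assms(1) by (intro mult_le_cancel_left1[THEN iffD2]) (auto simp: field_simps)
  finally have "(ln 9216 + 2 * ln (real q) + 2 * \<tau>) / (4 * \<tau>) \<le> (14 + 2 * real q) * 2 * q + 1 / 2"
    using \<tau>0 by (simp add: field_simps)
  also have "1 + ((14 + 2 * real q) * 2 * q + 1 / 2) \<le> 20 * (real q)\<^sup>2"
  proof -
    have "2 * real q \<le> real q * q" using assms(1) by (intro mult_right_mono) auto
    moreover have "2 \<le> real q" using assms(1) by simp
    moreover have "(14 + 2 * real q) * 2 * q = 28 * real q + 4 * (real q * q)" by (simp add: algebra_simps)
    ultimately show ?thesis unfolding power2_eq_square by linarith
  qed
  finally show ?thesis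
    unfolding lnW ln_inverse_power4(2)[OF assms(2,3)] \<tau>_def by simp
qed

text \<open>Each run length with many periods is charged the energy drop between its two scales, at
  least \<open>\<epsilon>^2 n / (24 q)\<close>. A dyadic step serves at most \<open>20 q^2\<close>
  run lengths and all steps together lose at most \<open>q n\<close>, which gives
  \<open>480 q^4 / \<epsilon>^2\<close>; the remaining long runs fit into one window.\<close>

lemma card_list_far_from_1:
  fixes \<epsilon> :: real
  assumes q: "q \<ge> 2" and \<epsilon>: "0 < \<epsilon>" "\<epsilon> < 1" "1 \<le> 8 * q * (1 - \<epsilon>)"
    and z: "1 \<le> z" "z \<le> q" and v: "length v \<le> q * n" and n: "0 < n"
    and R: "\<And>r. r \<in> R \<Longrightarrow> r < n \<and> (\<exists>k. r = nat \<lfloor>(1 / \<epsilon> ^ 4) ^ k\<rfloor>)"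
    and match: "\<And>r. r \<in> R \<Longrightarrow> \<exists>s. subseq s (A_prefix q r n) \<and> subseq s v \<and>
      n * (real z * (real z + 1)) / q + \<epsilon> * n * z \<le> (2 * real z + 1) * length s - length v"
  shows "real (card R) \<le> 1000 * real q ^ 5 / \<epsilon>\<^sup>2"
proof -
  define b where "b = 1 / \<epsilon> ^ 4"
  define W where "W = 9216 * (real q)\<^sup>2 / \<epsilon>\<^sup>2"
  have b: "1 < b" unfolding b_def by (rule ln_inverse_power4(1)[OF \<epsilon>(1,2)])
  have fin: "finite R" using R by (intro finite_subset[of R "{..<n}"]) auto
  have Rpos: "0 < r" if r: "r \<in> R" for r
  proof -
    obtain k where "r = nat \<lfloor>b ^ k\<rfloor>" using R[OF r] by (auto simp: b_def)
    moreover have "1 \<le> b ^ k" using b by simp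
    ultimately show ?thesis by simp
  qed
  have q2: "4 \<le> (real q)\<^sup>2"
    using q power_mono[of 2 "real q" 2] by simp
  have "\<epsilon> * \<epsilon> < 1 * 1" using \<epsilon> by (intro mult_strict_mono) auto
  then have \<epsilon>2: "\<epsilon>\<^sup>2 < 1" by (simp add: power2_eq_square)
  have W1: "1 \<le> W" using \<epsilon> q2 \<epsilon>2 unfolding W_def by (simp add: pos_le_divide_eq)
  \<comment> \<open>The factor 2 absorbs the rounding:
    \<open>b ^ k < r + 1 \<le> 2 r\<close>.\<close>
  have window: "real (card S) \<le> 20 * (real q)\<^sup>2"
    if S: "S \<subseteq> R" "0 < y" "\<And>r. r \<in> S \<Longrightarrow> y \<le> r \<and> 2 * real r \<le> W * y" for S and y :: real
  proof -
    have "real (card S) \<le> 1 + ln W / ln b"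
    proof (rule card_powers_in_window[OF b S(2) W1])
      fix r assume r: "r \<in> S"
      obtain k where k: "r = nat \<lfloor>b ^ k\<rfloor>" using R r S(1) by (auto simp: b_def)
      have "0 < r" using Rpos r S(1) by auto
      then have "real r \<le> b ^ k" "b ^ k \<le> 2 * r" unfolding k by linarith+
      then have "y \<le> b ^ k \<and> b ^ k \<le> W * y" using S(3)[OF r] by linarith
      then show "\<exists>k. r = nat \<lfloor>b ^ k\<rfloor> \<and> y \<le> b ^ k \<and> b ^ k \<le> W * y" using k by blast
    qed
    also have "\<dots> \<le> 20 * (real q)\<^sup>2"
      unfolding W_def b_def by (rule window_bound[OF q \<epsilon>])
    finally show ?thesis .
  qed
  \<comment> \<open>Run lengths with too few periods within \<open>n\<close> for
    \<open>energy_increment\<close>; they lie between \<open>\<epsilon> n / (24 q)\<close> and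
    \<open>n\<close>.\<close>
  define Rl where "Rl = {r\<in>R. \<epsilon> * n < 24 * real q * r}"
  define Rs where "Rs = {r\<in>R. 24 * real q * r \<le> \<epsilon> * n}"
  have large: "real (card Rl) \<le> 20 * (real q)\<^sup>2"
  proof (rule window[where y = "\<epsilon> * n / (24 * q)"])
    show "Rl \<subseteq> R" by (auto simp: Rl_def)
    show "0 < \<epsilon> * n / (24 * q)" using \<epsilon> q n by simp
    fix r assume r: "r \<in> Rl"
    have "2 * real r \<le> W * (\<epsilon> * n / (24 * q))"
    proof -
      have "real r \<le> n" using R r by (auto simp: Rl_def less_imp_le)
      moreover have "2 * real n \<le> 384 * real q * n / \<epsilon>"
      proof -
        have "\<epsilon> * (2 * real n) \<le> 1 * (2 * real n)" using \<epsilon> by (intro mult_right_mono) auto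
        also have "\<dots> \<le> 384 * real q * n" using mult_right_mono[of 2 "384 * real q" "real n"] q by simp
        finally show ?thesis using \<epsilon> by (simp add: field_simps)
      qed
      moreover have "W * (\<epsilon> * n / (24 * q)) = 384 * real q * n / \<epsilon>"
        using \<epsilon> q by (simp add: W_def field_simps power2_eq_square)
      ultimately show ?thesis by simp
    qed
    then show "\<epsilon> * n / (24 * q) \<le> r \<and> 2 * real r \<le> W * (\<epsilon> * n / (24 * q))"
      using r q by (auto simp: Rl_def field_simps)
  qed
  \<comment> \<open>The fine scale is the largest power of two with
    \<open>96 (2 ^ lo r - 1) \<le> \<epsilon> r\<close>; the added 1 makes it exist for short runs
    too.\<close>
  have "\<exists>j. 2 ^ j \<le> \<epsilon> * r / 96 + 1 \<and> \<epsilon> * r / 96 + 1 < 2 ^ Suc j" for r :: nat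
    using \<epsilon> by (intro ex_power_of_2_between) auto
  then obtain lo :: "nat \<Rightarrow> nat" where lo: "\<And>r :: nat. 2 ^ lo r \<le> \<epsilon> * r / 96 + 1" "\<And>r :: nat. \<epsilon> * r / 96 + 1 < 2 ^ Suc (lo r)"
    by metis
  have scale1: "1 \<le> 24 * (real q)\<^sup>2 * r / \<epsilon>" "\<epsilon> * r / 96 + 1 \<le> 24 * (real q)\<^sup>2 * r / \<epsilon>"
    if "0 < r" for r :: nat
  proof -
    have "\<epsilon> * (\<epsilon> * r / 96 + 1) \<le> 1 * (r / 96 + 1)"
      using \<epsilon> by (intro mult_mono) (auto simp: mult_left_le_one_le)
    also have "\<dots> \<le> 24 * 4 * real r" using that by simp
    also have "\<dots> \<le> 24 * (real q)\<^sup>2 * r" using q2 by (intro mult_right_mono) auto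
    finally show *: "\<epsilon> * r / 96 + 1 \<le> 24 * (real q)\<^sup>2 * r / \<epsilon>" using \<epsilon> by (simp add: field_simps)
    have "0 \<le> \<epsilon> * r / 96" using \<epsilon> by simp
    with * show "1 \<le> 24 * (real q)\<^sup>2 * r / \<epsilon>" by linarith
  qed
  \<comment> \<open>The coarse scale, one doubling above \<open>2 ^ pre r\<close>, is the first
    power of two beyond \<open>24 q^2 r / \<epsilon>\<close>.\<close>
  have "\<forall>r\<in>R. \<exists>j. 2 ^ j \<le> 24 * (real q)\<^sup>2 * r / \<epsilon> \<and> 24 * (real q)\<^sup>2 * r / \<epsilon> < 2 ^ Suc j"
    using scale1(1) Rpos ex_power_of_2_between by blast
  then obtain pre :: "nat \<Rightarrow> nat" where pre: "\<And>r. r \<in> R \<Longrightarrow> 2 ^ pre r \<le> 24 * (real q)\<^sup>2 * r / \<epsilon>"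
    "\<And>r. r \<in> R \<Longrightarrow> 24 * (real q)\<^sup>2 * r / \<epsilon> < 2 ^ Suc (pre r)" by metis
  define hi where "hi = (\<lambda>r. Suc (pre r))"
  have lo_hi: "lo r < hi r" if "r \<in> R" for r
  proof -
    have "(2::real) ^ lo r < 2 ^ hi r"
      using lo(1)[of r] pre(2)[OF that] scale1(2)[OF Rpos[OF that]] unfolding hi_def by linarith
    then show ?thesis by simp
  qed
  \<comment> \<open>A crude common bound on the scales suffices because the energies telescope; the
    summand \<open>length v\<close> makes \<open>2 ^ H\<close> reach past the end of
    \<open>v\<close>.\<close>
  define H where "H = length v + (\<Sum>r\<in>Rs. hi r)"
  define E where "E = (\<lambda>j. energy {1..q} v (2 ^ H) (2 ^ j))"
  have finRs: "finite Rs" using fin by (simp add: Rs_def)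
  have hi_H: "hi r \<le> H" if "r \<in> Rs" for r
    using member_le_sum[OF that _ finRs, of hi] by (simp add: H_def)
  have v_le: "length v \<le> 2 ^ H"
  proof -
    have "length v \<le> H" by (simp add: H_def)
    then show ?thesis using less_exp[of H] by linarith
  qed
  have E_step: "0 \<le> E j - E (Suc j)" if "j < H" for j
    using energy_antimono[of "2 ^ j" "2 ^ Suc j" "2 ^ H" "{1..q}" v] that
    unfolding E_def by (simp add: le_imp_power_dvd del: power_Suc)
  have increment: "\<epsilon>\<^sup>2 * n \<le> 24 * real q * (E (lo r) - E (hi r))" if r: "r \<in> Rs" for r
  proof -
    have rR: "r \<in> R" using r by (simp add: Rs_def)
    obtain s where s: "subseq s (A_prefix q r n)" "subseq s v"
      "n * (real z * (real z + 1)) / q + \<epsilon> * n * z \<le> (2 * real z + 1) * length s - length v"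
      using match[OF rR] by blast
    show ?thesis unfolding E_def
    proof (rule energy_increment[OF _ z Rpos[OF rR] \<epsilon>(1,2) s v v_le])
      show "96 * real (2 ^ lo r - 1) \<le> \<epsilon> * real r"
        using lo(1)[of r] by (simp add: of_nat_diff)
      have "24 * (real q)\<^sup>2 * r < 2 ^ hi r * \<epsilon>"
        using pre(2)[OF rR] \<epsilon> unfolding hi_def by (simp only: pos_divide_less_eq)
      then show "24 * (real q)\<^sup>2 * r \<le> \<epsilon> * real (2 ^ hi r)" by (simp add: mult.commute)
      show "2 ^ lo r dvd (2 ^ hi r :: nat)" using lo_hi[OF rR] by (simp add: le_imp_power_dvd)
      show "2 ^ hi r dvd (2 ^ H :: nat)" using hi_H[OF r] by (simp add: le_imp_power_dvd)
      show "24 * real q * r \<le> \<epsilon> * n" using r by (simp add: Rs_def)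
    qed (use q in auto)
  qed
  \<comment> \<open>The run lengths whose span of scales contains the step from \<open>2 ^ j\<close>
    to \<open>2 ^ Suc j\<close>.\<close>
  define act where "act = (\<lambda>j. {r\<in>Rs. lo r \<le> j \<and> j < hi r})"
  have active: "real (card (act j)) \<le> 20 * (real q)\<^sup>2" for j
  proof -
    \<comment> \<open>Activity at \<open>j\<close> implies
      \<open>y \<le> r < 192 * 2 ^ j / \<epsilon>\<close>; doubled for rounding, the upper end is
      \<open>W * y\<close>.\<close>
    define y where "y = 2 ^ j * \<epsilon> / (24 * (real q)\<^sup>2)"
    show ?thesis
    proof (rule window[where y = y])
    show "act j \<subseteq> R" by (auto simp: act_def Rs_def)
    show "0 < y" using \<epsilon> q by (simp add: y_def)
    fix r assume "r \<in> act j"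
    then have r: "r \<in> R" "lo r \<le> j" "j \<le> pre r" by (auto simp: act_def Rs_def hi_def)
    have "(2::real) ^ j \<le> 2 ^ pre r" using r(3) by (intro power_increasing) auto
    then have "2 ^ j \<le> 24 * (real q)\<^sup>2 * r / \<epsilon>" using pre(1)[OF r(1)] by linarith
    then have "y \<le> r" using \<epsilon> q by (simp add: y_def field_simps)
    moreover have "(2::real) ^ lo r \<le> 2 ^ j" using r(2) by (intro power_increasing) auto
    then have "\<epsilon> * r \<le> 192 * 2 ^ j" using lo(2)[of r] unfolding power_Suc by linarith
    then have "2 * real r \<le> 384 * 2 ^ j / \<epsilon>" using \<epsilon> by (simp add: field_simps)
    moreover have "W * y = 384 * 2 ^ j / \<epsilon>"
      using \<epsilon> q by (simp add: W_def y_def field_simps power2_eq_square)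
    ultimately show "y \<le> r \<and> 2 * real r \<le> W * y" by simp
    qed
  qed
  have "card Rs * (\<epsilon>\<^sup>2 * n) = (\<Sum>r\<in>Rs. \<epsilon>\<^sup>2 * n)" by simp
  also have "\<dots> \<le> (\<Sum>r\<in>Rs. 24 * real q * (E (lo r) - E (hi r)))" by (intro sum_mono increment)
  also have "\<dots> = 24 * real q * (\<Sum>r\<in>Rs. \<Sum>j\<in>{lo r..<hi r}. E j - E (Suc j))"
  proof -
    have "(\<Sum>j\<in>{lo r..<hi r}. E j - E (Suc j)) = E (lo r) - E (hi r)" if "r \<in> Rs" for r
      using sum_Suc_diff'[of "lo r" "hi r" "\<lambda>j. - E j"] lo_hi[of r] that by (simp add: Rs_def)
    then show ?thesis by (simp add: sum_distrib_left cong: sum.cong)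
  qed
  also have "(\<Sum>r\<in>Rs. \<Sum>j\<in>{lo r..<hi r}. E j - E (Suc j)) =
      (\<Sum>r\<in>Rs. \<Sum>j | j \<in> {..<H} \<and> lo r \<le> j \<and> j < hi r. E j - E (Suc j))"
    by (intro sum.cong refl) (use hi_H in fastforce)
  \<comment> \<open>The charges are regrouped by dyadic step.\<close>
  also have "\<dots> = (\<Sum>j<H. \<Sum>r\<in>act j. E j - E (Suc j))"
    unfolding act_def by (rule sum.swap_restrict[OF finRs]) simp
  also have "\<dots> = (\<Sum>j<H. card (act j) * (E j - E (Suc j)))" by simp
  also have "24 * real q * \<dots> \<le> 24 * real q * (\<Sum>j<H. 20 * (real q)\<^sup>2 * (E j - E (Suc j)))"
    by (intro mult_left_mono sum_mono mult_right_mono active E_step) auto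
  also have "\<dots> = 480 * real q ^ 3 * (E 0 - E H)"
    using sum_lessThan_telescope'[of E H]
    by (simp add: sum_distrib_left[symmetric] power3_eq_cube power2_eq_square)
  also have "\<dots> \<le> 480 * real q ^ 3 * (q * n)"
  proof (intro mult_left_mono)
    have "E 0 - E H \<le> length v"
      using energy_one_le[OF _ v_le, of "{1..q}"] energy_nonneg[of "{1..q}" v "2 ^ H" "2 ^ H"]
      by (simp add: E_def)
    also have "\<dots> \<le> q * n" using v by (metis of_nat_le_iff of_nat_mult)
    finally show "E 0 - E H \<le> q * n" .
  qed auto
  finally have "card Rs * \<epsilon>\<^sup>2 * n \<le> 480 * real q ^ 4 * n" by (simp add: power_numeral_reduce mult_ac)
  then have "card Rs * \<epsilon>\<^sup>2 \<le> 480 * real q ^ 4" using n by simp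
  moreover have "card Rl * \<epsilon>\<^sup>2 \<le> 20 * (real q)\<^sup>2 * 1" using large \<epsilon>2 by (intro mult_mono) auto
  moreover have "card R * \<epsilon>\<^sup>2 = card Rs * \<epsilon>\<^sup>2 + card Rl * \<epsilon>\<^sup>2"
  proof -
    have "card R = card Rs + card Rl"
      using fin by (subst card_Un_disjoint[symmetric]) (auto simp: Rs_def Rl_def intro: arg_cong[where f = card])
    then show ?thesis by (simp add: algebra_simps)
  qed
  moreover have "0 \<le> real q ^ 5" by simp
  moreover have "(real q)\<^sup>2 \<le> real q ^ 5" "real q ^ 4 \<le> real q ^ 5" using q by (auto intro: power_increasing)
  ultimately have "card R * \<epsilon>\<^sup>2 \<le> 1000 * real q ^ 5" by linarith
  then show ?thesis using \<epsilon> by (simp add: field_simps)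
qed

section \<open>Parameters close to 1\<close>

text \<open>Here \<open>v\<close> is so close to each codeword that any two of them are close to each other, which
  forces their run lengths to agree up to a factor \<open>1 + O(q (1 - \<epsilon>))\<close>.\<close>
lemma card_list_near_1:
  fixes \<epsilon> \<gamma> \<delta> :: real
  assumes q: "q \<ge> 2" and \<epsilon>: "0 < \<epsilon>" "\<epsilon> < 1" "8 * q * (1 - \<epsilon>) \<le> 1"
    and dist: "\<gamma> + \<delta> \<le> q * (1 - \<epsilon>)"
    and R: "\<And>r. r \<in> R \<Longrightarrow> r < n \<and> (\<exists>k. r = nat \<lfloor>(1 / \<epsilon> ^ 4) ^ k\<rfloor>)"
    and match: "\<And>r. r \<in> R \<Longrightarrow> \<exists>s. subseq s (A_prefix q r n) \<and> subseq s v \<and>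
      real n - length s \<le> \<delta> * n \<and> real (length v) - length s \<le> \<gamma> * n"
  shows "real (card R) \<le> 8 * real q + 1"
proof (cases "R = {}")
  case False
  define b where "b = 1 / \<epsilon> ^ 4"
  define \<eta> where "\<eta> = 1 - \<epsilon>"
  have \<eta>: "0 < \<eta>" "8 * q * \<eta> \<le> 1" using \<epsilon> by (auto simp: \<eta>_def)
  have b: "1 < b" unfolding b_def by (rule ln_inverse_power4(1)[OF \<epsilon>(1,2)])
  have fin: "finite R" using R by (intro finite_subset[of R "{..<n}"]) auto
  have Rk: "\<exists>k. r = nat \<lfloor>b ^ k\<rfloor> \<and> real r \<le> b ^ k \<and> b ^ k \<le> real r + 1 \<and> 0 < r" if r: "r \<in> R" for r
  proof -
    obtain k where k: "r = nat \<lfloor>b ^ k\<rfloor>" using R[OF r] by (auto simp: b_def)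
    moreover have "1 \<le> b ^ k" using b by simp
    ultimately have "real r \<le> b ^ k \<and> b ^ k \<le> real r + 1 \<and> 0 < r" by linarith
    then show ?thesis using k by blast
  qed
  have close: "real r' \<le> r + 8 * q * \<eta> * r" if r: "r \<in> R" "r' \<in> R" "r < r'" for r r'
  proof -
    obtain s where s: "subseq s (A_prefix q r n)" "subseq s v" "real (length v) - length s \<le> \<gamma> * n"
      using match[OF r(1)] by blast
    obtain s' where s': "subseq s' (A_prefix q r' n)" "subseq s' v" "real n - length s' \<le> \<delta> * n"
      using match[OF r(2)] by blast
    \<comment> \<open>The length of \<open>u\<close> misses \<open>n\<close> by at most the
      insertions for \<open>s\<close> plus the deletions for \<open>s'\<close>, together
      \<open>(\<gamma> + \<delta>) n\<close>.\<close>
    obtain u where u: "subseq u s" "subseq u s'" "length s + length s' \<le> length u + length v"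
      using subseq_common_part[OF s(2) s'(2)] by blast
    define K where "K = n div r'"
    have pos: "0 < r" "0 < r'" using Rk r by blast+
    have "2 * length u + K * r' \<le> 2 * n + K * r"
      unfolding K_def using u s(1) s'(1) pos q
      by (intro common_subseq_A_prefix) (auto intro: subseq_order.order_trans)
    then have "real (2 * length u + K * r') \<le> real (2 * n + K * r)" by (simp only: of_nat_le_iff)
    then have "K * (real r' - r) \<le> 2 * (real n - length u)" by (simp add: algebra_simps)
    also have "real n - length u \<le> (\<gamma> + \<delta>) * n" using u(3) s(3) s'(3) by (simp add: algebra_simps)
    also have "(\<gamma> + \<delta>) * n \<le> q * \<eta> * n" using dist unfolding \<eta>_def by (intro mult_right_mono) auto
    also have "\<dots> \<le> q * \<eta> * (2 * (K * r'))"
    proof (intro mult_left_mono)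
      have "n = K * r' + n mod r'" by (simp add: K_def)
      moreover have "n mod r' < r'" using pos by simp
      moreover have "1 \<le> K" using R[OF r(2)] pos by (simp add: K_def div_greater_zero_iff Suc_leI)
      then have "r' \<le> K * r'" by simp
      ultimately have "n \<le> 2 * (K * r')" by linarith
      then show "real n \<le> 2 * (K * r')" by (metis of_nat_le_iff of_nat_mult of_nat_numeral)
    qed (use \<eta> in auto)
    finally have "K * (real r' - r) \<le> K * (4 * q * \<eta> * r')" by (simp add: mult_ac)
    moreover have "0 < K" using R[OF r(2)] pos by (simp add: K_def div_greater_zero_iff)
    ultimately have *: "real r' - r \<le> 4 * q * \<eta> * r'" by simp
    \<comment> \<open>As \<open>4 q \<eta> \<le> 1 / 2\<close>, the estimate first gives
      \<open>r' \<le> 2 r\<close>, which then replaces \<open>r'\<close> on its own right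
      side.\<close>
    have "8 * q * \<eta> * r' \<le> 1 * real r'" using \<eta> by (intro mult_right_mono) auto
    with * have "real r' \<le> 2 * r" by simp
    then have "4 * q * \<eta> * r' \<le> 4 * q * \<eta> * (2 * r)" using \<eta> by (intro mult_left_mono) auto
    with * show ?thesis by (simp add: mult_ac)
  qed
  define r0 where "r0 = Min R"
  have r0: "r0 \<in> R" "\<And>r. r \<in> R \<Longrightarrow> r0 \<le> r" using fin False by (auto simp: r0_def)
  have r0_pos: "0 < r0" using Rk r0 by blast
  have upper: "real r \<le> r0 + 8 * q * \<eta> * r0" if "r \<in> R" for r
    using close[OF r0(1) that] r0(2)[OF that] \<eta> by (cases "r = r0") auto
  show ?thesis
  \<comment> \<open>For small \<open>r0\<close> the rounding of powers is not negligible, but the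
    interval holds few integers. Otherwise \<open>1 \<le> q \<eta> r0\<close> absorbs the rounding
    and turns the factor 8 into the 9 of \<open>W\<close>.\<close>
  proof (cases "r0 * \<eta> \<le> 1")
    case True
    have "R \<subseteq> {r0..r0 + 8 * q}"
    proof
      fix r assume r: "r \<in> R"
      have "8 * real q * (r0 * \<eta>) \<le> 8 * real q * 1" using True by (intro mult_left_mono) auto
      then have "real r \<le> real (r0 + 8 * q)" using upper[OF r] by (simp add: mult_ac)
      then show "r \<in> {r0..r0 + 8 * q}" using r0(2)[OF r] by (simp only: of_nat_le_iff) simp
    qed
    then have "card R \<le> card {r0..r0 + 8 * q}" by (intro card_mono) auto
    then show ?thesis by simp
  next
    case False
    define W where "W = 1 + 9 * q * \<eta>"
    have W: "1 \<le> W" using \<eta> by (simp add: W_def)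
    have "real (card R) \<le> 1 + ln W / ln b"
    proof (rule card_powers_in_window[OF b _ W])
      show "0 < real r0" using r0_pos by simp
      fix r assume r: "r \<in> R"
      obtain k where k: "r = nat \<lfloor>b ^ k\<rfloor>" "real r \<le> b ^ k" "b ^ k \<le> real r + 1" using Rk[OF r] by blast
      have "1 * 1 \<le> q * (r0 * \<eta>)" using False q by (intro mult_mono) auto
      then have "b ^ k \<le> W * r0" using k(3) upper[OF r] by (simp add: W_def algebra_simps)
      moreover have "real r0 \<le> b ^ k" using r0(2)[OF r] k(2) by linarith
      ultimately show "\<exists>k. r = nat \<lfloor>b ^ k\<rfloor> \<and> real r0 \<le> b ^ k \<and> b ^ k \<le> W * real r0" using k(1) by blast
    qed
    \<comment> \<open>Window width and growth rate are both linear in \<open>\<eta>\<close>, which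
      cancels, so the bound is uniform as \<open>\<epsilon>\<close> tends to 1.\<close>
    also have "ln W / ln b \<le> 9 * q * \<eta> / (4 * \<eta>)"
    proof (rule frac_le)
      have "0 < W" using W by simp
      from ln_le_minus_one[OF this] show "ln W \<le> 9 * q * \<eta>" by (simp add: W_def)
      show "4 * \<eta> \<le> ln b"
        unfolding b_def ln_inverse_power4(2)[OF \<epsilon>(1,2)] \<eta>_def using ln_inverse_power4(3)[OF \<epsilon>(1,2)] by simp
    qed (use \<eta> in auto)
    also have "9 * q * \<eta> / (4 * \<eta>) \<le> 8 * q" using \<eta> by simp
    finally show ?thesis by simp
  qed
qed simp

section \<open>The distance condition and the conclusion\<close>

text \<open>Weighting deletions by \<open>2 z\<close> and insertions by 1 gives
  \<open>(2 z + 1) L - m \<ge> 2 z n - (1 - \<epsilon>) P n\<close> with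
  \<open>P = 2 z - z (z + 1) / q\<close>, and \<open>z < q\<close> gives
  \<open>P \<ge> z\<close>.\<close>

lemma gain_of_distance:
  fixes q z n L m :: nat and \<epsilon> \<gamma> \<delta> :: real
  assumes "1 \<le> z" "z < q" "0 \<le> \<epsilon>"
    and "\<gamma> + 2 * real z * \<delta> \<le> (1 - \<epsilon>) * (((2 * real q - 1) * real z - (real z)\<^sup>2) / real q)"
    and "real n - L \<le> \<delta> * n" "real m - L \<le> \<gamma> * n"
  shows "n * (real z * (real z + 1)) / q + \<epsilon> * n * z \<le> (2 * real z + 1) * L - m"
proof -
  define P where "P = ((2 * real q - 1) * real z - (real z)\<^sup>2) / real q"
  have P: "P = 2 * z - real z * (real z + 1) / q"
    using assms(2) by (simp add: P_def field_simps power2_eq_square)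
  have "real z \<le> P"
  proof -
    have "real z * q \<le> real z * (2 * real q - 1 - z)"
      using assms(2) by (intro mult_left_mono) auto
    then show ?thesis using assms(2) by (simp add: P_def field_simps power2_eq_square)
  qed
  then have "\<epsilon> * n * z \<le> \<epsilon> * n * P" using assms(3) by (intro mult_left_mono) auto
  moreover have "(\<gamma> + 2 * real z * \<delta>) * n \<le> ((1 - \<epsilon>) * P) * n"
    using assms(4) unfolding P_def by (intro mult_right_mono) auto
  moreover have "2 * real z * (real n - L) \<le> 2 * real z * (\<delta> * n)"
    using assms(5) by (intro mult_left_mono) auto
  moreover have "n * P = 2 * z * n - n * (real z * (real z + 1)) / q"
    unfolding P by (simp add: algebra_simps)
  ultimately show ?thesis using assms(6) by (simp add: algebra_simps)
qed

theorem theorem5p3: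
  "\<exists>C::real. C > 0 \<and>
     (\<forall>(q::nat) (\<epsilon>::real). q \<ge> 2 \<longrightarrow> 0 < \<epsilon> \<longrightarrow> \<epsilon> < 1 \<longrightarrow>
       (\<exists>N::nat. \<forall>n \<ge> N. \<forall>(z::nat) (\<gamma>::real) (\<delta>::real).
          1 \<le> z \<longrightarrow> z \<le> q - 1 \<longrightarrow> \<gamma> \<ge> 0 \<longrightarrow> \<delta> \<ge> 0 \<longrightarrow>
          \<gamma> + 2 * real z * \<delta> \<le> (1 - \<epsilon>) * (((2 * real q - 1) * real z - (real z)\<^sup>2) / real q) \<longrightarrow>
          (\<forall>v::nat list. set v \<subseteq> {1..q} \<longrightarrow>
             real (card {c \<in> code_C q \<epsilon> n. \<exists>D I. real D \<le> \<delta> * real n \<and> real I \<le> \<gamma> * real n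
                                                 \<and> obtained_by_del_ins c v D I})
               \<le> C * real q ^ 5 / \<epsilon>\<^sup>2)))"
proof (intro exI[of _ "1000 :: real"] conjI allI impI exI[of _ "0 :: nat"])
  \<comment> \<open>The bound holds with constant 1000 for every \<open>n\<close>, so 0 serves as
    the threshold.\<close>
  fix q :: nat and \<epsilon> :: real and n z :: nat and \<gamma> \<delta> :: real and v :: "nat list"
  assume q: "q \<ge> 2" and \<epsilon>: "0 < \<epsilon>" "\<epsilon> < 1" and z: "1 \<le> z" "z \<le> q - 1" and nonneg: "\<gamma> \<ge> 0" "\<delta> \<ge> 0"
    and dist: "\<gamma> + 2 * real z * \<delta> \<le> (1 - \<epsilon>) * (((2 * real q - 1) * real z - (real z)\<^sup>2) / real q)"
  define good where "good = (\<lambda>c. \<exists>D I. real D \<le> \<delta> * real n \<and> real I \<le> \<gamma> * real n \<and> obtained_by_del_ins c v D I)"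
  \<comment> \<open>Since \<open>r\<close> determines the codeword, run lengths may be counted
    instead.\<close>
  define R where "R = {r. r < n \<and> (\<exists>k. r = nat \<lfloor>(1 / \<epsilon> ^ 4) ^ k\<rfloor>) \<and> good (A_prefix q r n)}"
  have zq: "z < q" using z q by simp
  have "{c \<in> code_C q \<epsilon> n. good c} \<subseteq> (\<lambda>r. A_prefix q r n) ` R"
  proof
    fix c assume "c \<in> {c \<in> code_C q \<epsilon> n. good c}"
    then obtain k where c: "good c" "c = A_prefix q (nat \<lfloor>(1 / \<epsilon> ^ 4) ^ k\<rfloor>) n"
      and k: "real k < log (1 / \<epsilon> ^ 4) (real n)"
      by (auto simp: code_C_def)
    have b: "1 < 1 / \<epsilon> ^ 4" by (rule ln_inverse_power4(1)[OF \<epsilon>])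
    \<comment> \<open>For \<open>n = 0\<close> the default value \<open>ln 0 = 0\<close> admits no
      \<open>k\<close>.\<close>
    have "0 < n" using k by (cases "n = 0") (auto simp: log_def)
    then have "(1 / \<epsilon> ^ 4) powr real k < n" using k b by (subst (asm) less_log_iff) auto
    then have less: "(1 / \<epsilon> ^ 4) ^ k < n" using b by (subst (asm) powr_realpow) auto
    moreover have "1 \<le> (1 / \<epsilon> ^ 4) ^ k" by (rule one_le_power) (use b in simp)
    ultimately have "nat \<lfloor>(1 / \<epsilon> ^ 4) ^ k\<rfloor> < n" by linarith
    then show "c \<in> (\<lambda>r. A_prefix q r n) ` R" using c by (auto simp: R_def)
  qed
  moreover have "finite R" by (rule finite_subset[of R "{..<n}"]) (auto simp: R_def)
  ultimately have card: "card {c \<in> code_C q \<epsilon> n. good c} \<le> card R"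
    by (rule surj_card_le[rotated])
  have match: "\<exists>s. subseq s (A_prefix q r n) \<and> subseq s v \<and>
      real n - length s \<le> \<delta> * n \<and> real (length v) - length s \<le> \<gamma> * n" if r: "r \<in> R" for r
  proof -
    obtain D I s where "real D \<le> \<delta> * n" "real I \<le> \<gamma> * n" "subseq s (A_prefix q r n)" "subseq s v"
      "n = length s + D" "length v = length s + I"
      using r by (auto simp: R_def good_def obtained_by_del_ins_def)
    then show ?thesis by (intro exI[of _ s]) auto
  qed
  have dist_le: "(1 - \<epsilon>) * (((2 * real q - 1) * real z - (real z)\<^sup>2) / real q) \<le> (1 - \<epsilon>) * (real q - 1)"
  proof (intro mult_left_mono)
    \<comment> \<open>This product, divided by \<open>q\<close>, is the difference between
      \<open>q - 1\<close> and the right side of the distance condition without its factor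
      \<open>1 - \<epsilon>\<close>.\<close>
    have "0 \<le> (real q - z) * (real q - z - 1)" using zq by (intro mult_nonneg_nonneg) auto
    then show "((2 * real q - 1) * real z - (real z)\<^sup>2) / real q \<le> real q - 1"
      using q by (simp add: field_simps power2_eq_square)
  qed (use \<epsilon> in simp)
  have R: "r < n \<and> (\<exists>k. r = nat \<lfloor>(1 / \<epsilon> ^ 4) ^ k\<rfloor>)" if "r \<in> R" for r
    using that by (auto simp: R_def)
  have "real (card R) \<le> 1000 * real q ^ 5 / \<epsilon>\<^sup>2"
  proof (cases "R = {}")
    case False
    then obtain r where r: "r \<in> R" by blast
    show ?thesis
    proof (cases "1 \<le> 8 * real q * (1 - \<epsilon>)")
      case True
      show ?thesis
      proof (rule card_list_far_from_1[OF q \<epsilon> True z(1) less_imp_le[OF zq] _ _ R])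
        obtain s where s: "subseq s (A_prefix q r n)" "real (length v) - length s \<le> \<gamma> * n"
          using match[OF r] by blast
        \<comment> \<open>The bound \<open>\<gamma> \<le> q - 1\<close> limits \<open>v\<close> to
          length \<open>q n\<close>, and thereby the total energy.\<close>
        have "\<gamma> \<le> \<gamma> + 2 * real z * \<delta>" using nonneg by simp
        also have "\<dots> \<le> (1 - \<epsilon>) * (real q - 1)" using dist dist_le by linarith
        also have "\<dots> \<le> 1 * (real q - 1)" using \<epsilon> q by (intro mult_right_mono) auto
        finally have "\<gamma> * n \<le> (real q - 1) * n" by (intro mult_right_mono) auto
        moreover have "length s \<le> n" using list_emb_length[OF s(1)] by simp
        ultimately have "real (length v) \<le> real (q * n)" using s(2) by (simp add: algebra_simps)
        then show "length v \<le> q * n" by (simp only: of_nat_le_iff)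
        show "0 < n" using R[OF r] by simp
        fix r assume "r \<in> R"
        from match[OF this] show "\<exists>s. subseq s (A_prefix q r n) \<and> subseq s v \<and>
            n * (real z * (real z + 1)) / q + \<epsilon> * n * z \<le> (2 * real z + 1) * length s - length v"
          using gain_of_distance[OF z(1) zq less_imp_le[OF \<epsilon>(1)] dist] by blast
      qed
    next
      case False
      have "real (card R) \<le> 8 * real q + 1"
      proof (rule card_list_near_1[OF q \<epsilon> _ _ R match])
        show "8 * real q * (1 - \<epsilon>) \<le> 1" using False by simp
        have "\<delta> \<le> 2 * real z * \<delta>" using nonneg z mult_right_mono[of 1 "2 * real z" \<delta>] by simp
        then have "\<gamma> + \<delta> \<le> (1 - \<epsilon>) * (real q - 1)" using dist dist_le by linarith
        also have "\<dots> \<le> (1 - \<epsilon>) * q" using \<epsilon> by (intro mult_left_mono) auto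
        finally show "\<gamma> + \<delta> \<le> q * (1 - \<epsilon>)" by (simp add: mult.commute)
      qed
      also have "\<dots> \<le> 1000 * real q ^ 5"
      proof -
        have "real q \<le> real q ^ 5" "2 \<le> real q" using q power_increasing[of 1 5 "real q"] by auto
        then show ?thesis by linarith
      qed
      also have "\<dots> \<le> 1000 * real q ^ 5 / \<epsilon>\<^sup>2"
        using \<epsilon> by (simp add: pos_le_divide_eq mult_left_le power_le_one)
      finally show ?thesis .
    qed
  qed simp
  with card show "real (card {c \<in> code_C q \<epsilon> n. \<exists>D I. real D \<le> \<delta> * real n \<and> real I \<le> \<gamma> * real n
      \<and> obtained_by_del_ins c v D I}) \<le> 1000 * real q ^ 5 / \<epsilon>\<^sup>2"
    unfolding good_def by linarith
qed simp

end
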